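(* For every fixed integer $k>1$, \[ \mathrm{ex}_<\bigl(n,\ \mathcal{C}^B_4\cup\mathcal{C}^B_6\cup\dots\cup\mathcal{C}^B_{2k}\bigr)=\Theta\bigl(n^{1+1/k}\bigr)\qquad (n\to\infty), \] where $\mathcal{C}^B_{2j}$ denotes the set of bordered cycles of length $2j$, and the implied constants may depend on $k$.
   Context: An ordered graph is a finite simple graph together with a linear ordering of its vertex set. An ordered graph $G$ contains an ordered graph $H$ as an ordered subgraph if there is an injective, order-preserving map from the vertices of $H$ to the vertices of $G$ that maps edges of $H$ to edges of $G$ (the copy need not be induced). For a set $\mathcal{H}$ of ordered graphs, $\mathrm{ex}_<(n,\mathcal{H})$ is the maximum number of edges of an ordered graph on $n$ vertices that contains no $H\in\mathcal{H}$ as an ordered subgraph. The interval chromatic number of an ordered graph is the minimum number of intervals into which its linearly ordered vertex set can be partitioned so that no two vertices in the same interval are adjacent. In an ordered graph with interval chromatic number $2$ and intervals $U$ and $V$ ($U$ preceding $V$), an edge joining the first vertex of $U$ to the last vertex of $V$ is called an outer border, and an edge joining the last vertex of $U$ to the first vertex of $V$ is called an inner border. A bordered cycle is an ordered cycle (an ordered graph whose underlying graph is a cycle) with interval chromatic number $2$ that contains both an inner border and an outer border. $\mathcal{C}^B_{2j}$ is the set of all bordered cycles of length $2j$ (up to order-preserving isomorphism). *)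

theory Defs
  imports Complex_Main "HOL-Library.Disjoint_Sets" "HOL-Library.Landau_Symbols"
begin

(* The linear ordering of the vertex set is the one inherited from the vertex type.
   At type nat this covers every ordered graph up to order-preserving isomorphism. *)

record 'a ograph =
  verts :: "'a set"
  edges :: "'a set set"

definition ordered_graph :: "'a::linorder ograph \<Rightarrow> bool" where
  "ordered_graph G \<longleftrightarrow>
     finite (verts G) \<and> (\<forall>e \<in> edges G. e \<subseteq> verts G \<and> card e = 2)"

definition contains_ograph :: "'a::linorder ograph \<Rightarrow> 'b::linorder ograph \<Rightarrow> bool" where
  "contains_ograph G H \<longleftrightarrow>
     (\<exists>f. inj_on f (verts H) \<and> mono_on (verts H) f \<and> f ` verts H \<subseteq> verts G \<and>
          (\<forall>e \<in> edges H. f ` e \<in> edges G))"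

(* The set below is finite, its members being at most n choose 2. It is nonempty
   as soon as every graph in F has an edge. *)

definition ex_ord :: "nat \<Rightarrow> 'a::linorder ograph set \<Rightarrow> nat" where
  "ex_ord n F =
     Max {card (edges G) | G :: nat ograph.
            ordered_graph G \<and> card (verts G) = n \<and> (\<forall>H \<in> F. \<not> contains_ograph G H)}"

definition is_interval_in :: "'a::linorder set \<Rightarrow> 'a set \<Rightarrow> bool" where
  "is_interval_in V I \<longleftrightarrow>
     I \<subseteq> V \<and> (\<forall>x \<in> I. \<forall>z \<in> I. \<forall>y \<in> V. x \<le> y \<and> y \<le> z \<longrightarrow> y \<in> I)"

definition interval_coloring :: "'a::linorder ograph \<Rightarrow> 'a set set \<Rightarrow> bool" where
  "interval_coloring G P \<longleftrightarrow>
     partition_on (verts G) P \<and>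
     (\<forall>I \<in> P. is_interval_in (verts G) I \<and> (\<forall>x \<in> I. \<forall>y \<in> I. {x, y} \<notin> edges G))"

definition interval_chromatic_number :: "'a::linorder ograph \<Rightarrow> nat" where
  "interval_chromatic_number G = (LEAST m. \<exists>P. interval_coloring G P \<and> card P = m)"

definition is_cycle :: "'a::linorder ograph \<Rightarrow> bool" where
  "is_cycle G \<longleftrightarrow>
     (\<exists>vs. distinct vs \<and> length vs \<ge> 3 \<and> verts G = set vs \<and>
           edges G = {{vs ! i, vs ! (Suc i mod length vs)} | i. i < length vs})"

(* For a connected graph of interval chromatic number 2 the pair U, V is unique. *)

definition bordered_cycle :: "'a::linorder ograph \<Rightarrow> bool" where
  "bordered_cycle G \<longleftrightarrow>
     ordered_graph G \<and> is_cycle G \<and> interval_chromatic_number G = 2 \<and>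
     (\<exists>U V. interval_coloring G {U, V} \<and> (\<forall>u \<in> U. \<forall>v \<in> V. u < v) \<and>
            {Min U, Max V} \<in> edges G \<and> {Max U, Min V} \<in> edges G)"

definition bordered_cycles :: "nat \<Rightarrow> nat ograph set" where
  "bordered_cycles l = {G. bordered_cycle G \<and> card (verts G) = l}"

end

theory Submission
  imports Defs "HOL-Computational_Algebra.Polynomial_FPS" "HOL-Number_Theory.Cong"
begin

text \<open>Upper bound: a spiral is a path each of whose edges is nested inside the previous one, its
  two ends moving strictly inwards in turn. Two different spirals with the same end vertices contain
  a bordered cycle, which runs from where they part to where they first meet again. So there are at
  most \<open>n\<^sup>2\<close> spirals with \<open>k\<close> edges. On the other hand, deleting the \<open>d\<close> innermost edges at every
  vertex \<open>k - 1\<close> times, with \<open>d\<close> of order \<open>e / n\<close>, still leaves half of the \<open>e\<close> edges, and each of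
  these starts at least \<open>d ^ (k - 1)\<close> spirals.

  Lower bound: join \<open>u\<close> to \<open>u + d\<close> for all \<open>d\<close> in a set in which sums of at most \<open>k\<close> elements are
  unique. The alternating sum of the differences along a cycle vanishes, so every difference occurs
  both at an even and at an odd position; but the outer border of a bordered cycle is the only edge
  with the largest difference. A suitable set of order \<open>n\<close> to the power \<open>1 / k\<close> comes from the moment
  curve modulo a prime and Newton's identities. Primes of the right size exist because
  \<open>m * (2 * m choose m)\<close> divides the least common multiple of \<open>1, \<dots>, 2 * m\<close>.\<close>

subsection \<open>Nested paths and bordered cycles\<close>

text \<open>The ends of a single edge lie in different classes of every interval coloring, so one
  class never suffices.\<close>

lemma interval_chromatic_number_eq_2:
  assumes fin: "finite (verts G)" and col: "interval_coloring G {U, V}" and "U \<noteq> V"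
    and e: "{a, b} \<in> edges G" and ab: "a \<in> verts G" "b \<in> verts G"
  shows "interval_chromatic_number G = 2"
  unfolding interval_chromatic_number_def
proof (rule Least_equality)
  show "\<exists>P. interval_coloring G P \<and> card P = 2"
    using col \<open>U \<noteq> V\<close> by (intro exI[of _ "{U, V}"]) auto
next
  fix m
  assume "\<exists>P. interval_coloring G P \<and> card P = m"
  then obtain P where P: "interval_coloring G P" "card P = m"
    by blast
  then have part: "\<Union> P = verts G" and ne: "\<And>I. I \<in> P \<Longrightarrow> \<not> (a \<in> I \<and> b \<in> I)"
    using e by (auto simp: interval_coloring_def partition_on_def)
  obtain I J where IJ: "I \<in> P" "a \<in> I" "J \<in> P" "b \<in> J"
    using part ab by blast
  have "finite P"
    using part fin by (metis finite_UnionD)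
  moreover have "card {I, J} = 2"
    using IJ ne by (metis card_2_iff)
  ultimately show "2 \<le> m"
    using IJ P(2) card_mono[of P "{I, J}"] by auto
qed

definition cycle_graph :: "'a list \<Rightarrow> 'a ograph" where
  "cycle_graph vs =
     \<lparr>verts = set vs, edges = {{vs ! i, vs ! (Suc i mod length vs)} | i. i < length vs}\<rparr>"

lemma verts_cycle_graph [simp]: "verts (cycle_graph vs) = set vs"
  by (simp add: cycle_graph_def)

lemma edges_cycle_graph:
  "edges (cycle_graph vs) = {{vs ! i, vs ! (Suc i mod length vs)} | i. i < length vs}"
  by (simp add: cycle_graph_def)

text \<open>The predicate \<open>L\<close> marks the left interval, so that everything is tested on
  the sides of single vertices. The extremality hypotheses identify \<open>p\<close>,
  \<open>q\<close>, \<open>p'\<close>, \<open>q'\<close> with the \<open>Min\<close> and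
  \<open>Max\<close> in the definition of a bordered cycle.\<close>

lemma bordered_cycle_cycle_graph:
  fixes vs :: "'a::linorder list"
  assumes dist: "distinct vs" and len: "length vs \<ge> 3"
    and alt: "\<And>i. i < length vs \<Longrightarrow> L (vs ! i) \<noteq> L (vs ! (Suc i mod length vs))"
    and sep: "\<And>u v. \<lbrakk>u \<in> set vs; v \<in> set vs; L u; \<not> L v\<rbrakk> \<Longrightarrow> u < v"
    and outer: "{p, q} \<in> edges (cycle_graph vs)" "L p" "\<not> L q"
       "\<And>z. z \<in> set vs \<Longrightarrow> L z \<Longrightarrow> p \<le> z" "\<And>z. z \<in> set vs \<Longrightarrow> \<not> L z \<Longrightarrow> z \<le> q"
    and inner: "{p', q'} \<in> edges (cycle_graph vs)" "L p'" "\<not> L q'"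
       "\<And>z. z \<in> set vs \<Longrightarrow> L z \<Longrightarrow> z \<le> p'" "\<And>z. z \<in> set vs \<Longrightarrow> \<not> L z \<Longrightarrow> q' \<le> z"
  shows "bordered_cycle (cycle_graph vs)"
proof -
  let ?G = "cycle_graph vs"
  define U where "U = {z \<in> set vs. L z}"
  define V where "V = {z \<in> set vs. \<not> L z}"
  have sub: "e \<subseteq> set vs" if "e \<in> edges ?G" for e
    using that len by (auto simp: edges_cycle_graph intro!: nth_mem mod_less_divisor)
  have alt_e: "L a \<noteq> L b" if "{a, b} \<in> edges ?G" for a b
    using that alt by (fastforce simp: edges_cycle_graph doubleton_eq_iff)
  have pq: "p \<in> U" "q \<in> V" "p' \<in> U" "q' \<in> V"
    using sub[OF outer(1)] sub[OF inner(1)] outer inner by (auto simp: U_def V_def)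
  have fin: "finite U" "finite V"
    by (auto simp: U_def V_def)
  have "partition_on (set vs) {U, V}"
    using pq by (auto simp: partition_on_def disjoint_def U_def V_def)
  moreover have "is_interval_in (set vs) U" "is_interval_in (set vs) V"
    using sep by (force simp: is_interval_in_def U_def V_def dest: leD)+
  ultimately have col: "interval_coloring ?G {U, V}"
    using alt_e by (auto simp: interval_coloring_def U_def V_def)
  have "ordered_graph ?G"
    unfolding ordered_graph_def
  proof (intro conjI ballI)
    show "finite (verts ?G)" by simp
    fix e assume e: "e \<in> edges ?G"
    then show "e \<subseteq> verts ?G" using sub by simp
    show "card e = 2"
      using e alt by (auto simp: edges_cycle_graph card_2_iff) metis
  qed
  moreover have "is_cycle ?G"
    unfolding is_cycle_def using dist len by (intro exI[of _ vs]) (simp add: edges_cycle_graph)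
  moreover have "interval_chromatic_number ?G = 2"
    using outer(1) pq by (intro interval_chromatic_number_eq_2[OF _ col, of p q]) (auto simp: U_def V_def)
  moreover have "Min U = p"
    using pq fin outer(4) by (intro Min_eqI) (simp_all add: U_def)
  moreover have "Max V = q"
    using pq fin outer(5) by (intro Max_eqI) (simp_all add: V_def)
  moreover have "Max U = p'"
    using pq fin inner(4) by (intro Max_eqI) (simp_all add: U_def)
  moreover have "Min V = q'"
    using pq fin inner(5) by (intro Min_eqI) (simp_all add: V_def)
  moreover have "\<forall>u\<in>U. \<forall>v\<in>V. u < v"
    using sep by (auto simp: U_def V_def)
  ultimately show ?thesis
    unfolding bordered_cycle_def using col outer(1) inner(1) by blast
qed

section \<open>Spirals with common ends\<close>

text \<open>Every spiral begins at a left end, so the parity of an index tells the side of the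
  vertex. \<open>k\<close> counts edges; the values of \<open>x\<close> beyond \<open>k\<close> are
  unconstrained.\<close>

definition spiral :: "('a::linorder \<times> 'a) set \<Rightarrow> nat \<Rightarrow> (nat \<Rightarrow> 'a) \<Rightarrow> bool" where
  "spiral E k x \<longleftrightarrow>
     (\<forall>c<k. if even c then (x c, x (Suc c)) \<in> E else (x (Suc c), x c) \<in> E) \<and>
     (\<forall>c. Suc (Suc c) \<le> k \<longrightarrow> (if even c then x c < x (Suc (Suc c)) else x (Suc (Suc c)) < x c))"

lemma spiral_edge:
  assumes "spiral E k x" "c < k"
  shows "even c \<Longrightarrow> (x c, x (Suc c)) \<in> E" "odd c \<Longrightarrow> (x (Suc c), x c) \<in> E"
  using assms by (auto simp: spiral_def split: if_splits)

lemma spiral_step: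
  assumes "spiral E k x" "Suc (Suc c) \<le> k"
  shows "even c \<Longrightarrow> x c < x (Suc (Suc c))" "odd c \<Longrightarrow> x (Suc (Suc c)) < x c"
  using assms by (auto simp: spiral_def)

lemma spiral_less:
  assumes "spiral E k x" "c < d" "d \<le> k"
  shows "even c \<Longrightarrow> even d \<Longrightarrow> x c < x d" "odd c \<Longrightarrow> odd d \<Longrightarrow> x d < x c"
proof -
  have *: "(even c \<longrightarrow> x c < x (c + 2 * Suc m)) \<and> (odd c \<longrightarrow> x (c + 2 * Suc m) < x c)"
    if "c + 2 * Suc m \<le> k" for m
    using that
  proof (induction m)
    case 0
    then show ?case using spiral_step[OF assms(1), of c] by simp
  next
    case (Suc m)
    then show ?case using spiral_step[OF assms(1), of "c + 2 * Suc m"] by fastforce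
  qed
  have "\<exists>m. d = c + 2 * Suc m" if "even c = even d"
  proof -
    have "even (d - c)" using that assms(2) by simp
    then obtain m where "d - c = 2 * m" by blast
    with assms(2) show ?thesis by (intro exI[of _ "m - 1"]) (cases m; simp)
  qed
  then show "even c \<Longrightarrow> even d \<Longrightarrow> x c < x d" "odd c \<Longrightarrow> odd d \<Longrightarrow> x d < x c"
    using * assms(3) by blast+
qed

text \<open>Whether a vertex is the left or the right end of its edges can be read off the last vertex,
  so two spirals with a common last vertex agree on this.\<close>

lemma spiral_left_iff:
  assumes sp: "spiral E k x" and E: "\<And>u v. (u, v) \<in> E \<Longrightarrow> u < v" and "c \<le> k" and "0 < k"
  shows "(if even k then x c \<le> x k else x c < x k) \<longleftrightarrow> even c"
proof -
  \<comment> \<open>Left vertices increase and right vertices decrease along the spiral, so it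
    suffices to compare the last vertex with its predecessor, which lies on the other side.\<close>
  obtain k' where k': "k = Suc k'" using \<open>0 < k\<close> by (cases k) auto
  have last: "if even k' then x k' < x k else x k < x k'"
    using spiral_edge[OF sp, of k'] E k' by auto
  have le: "x c \<le> x d" if "even c" "even d" "c \<le> d" "d \<le> k" for d
    using spiral_less(1)[OF sp, of c d] that by (cases "c = d") auto
  have ge: "x d \<le> x c" if "odd c" "odd d" "c \<le> d" "d \<le> k" for d
    using spiral_less(2)[OF sp, of c d] that by (cases "c = d") auto
  consider "even c" "even k" | "odd c" "even k" | "even c" "odd k" | "odd c" "odd k" by blast
  then show ?thesis
  proof cases
    case 1
    then show ?thesis using le[of k] assms(3) by auto
  next
    case 2
    then have "c \<le> k'" using assms(3) k' by (cases "c = k") auto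
    then show ?thesis using 2 ge[of k'] last k' by auto
  next
    case 3
    then have "c \<le> k'" using assms(3) k' by (cases "c = k") auto
    then show ?thesis using 3 le[of k'] last k' by auto
  next
    case 4
    then show ?thesis using ge[of k] assms(3) by auto
  qed
qed

text \<open>A closed walk with \<open>w n = w 0\<close> replaces the index taken modulo the
  length.\<close>

lemma edges_cycle_graph_map:
  assumes "w n = w 0"
  shows "edges (cycle_graph (map w [0..<n])) = {{w t, w (Suc t)} | t. t < n}"
proof -
  have "map w [0..<n] ! (Suc t mod n) = w (Suc t)" if "t < n" for t
    using that assms by (cases "Suc t = n") auto
  then have "{map w [0..<n] ! t, map w [0..<n] ! (Suc t mod n)} = {w t, w (Suc t)}" if "t < n" for t
    using that by simp
  then show ?thesis
    unfolding edges_cycle_graph length_map length_upt diff_zero by blast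
qed

text \<open>Both spirals only move inwards after parting. So the outer border sits at the vertex
  where they part and the inner border at the vertex where they meet again, each leading to the more
  extreme of the two neighbours on the cycle.\<close>

lemma spirals_bordered_cycle:
  fixes x y :: "nat \<Rightarrow> 'a::linorder"
  assumes x: "spiral E k x" and y: "spiral E k y" and ends: "x 0 = y 0" "x k = y k"
    and E: "\<And>u v. (u, v) \<in> E \<Longrightarrow> u < v" and diff: "\<exists>c\<le>k. x c \<noteq> y c"
  obtains vs where "bordered_cycle (cycle_graph vs)" "distinct vs" "even (length vs)"
    "4 \<le> length vs" "length vs \<le> 2 * k" "edges (cycle_graph vs) \<subseteq> {{u, v} | u v. (u, v) \<in> E}"
proof -
  \<comment> \<open>The spirals part after \<open>i\<close>, the last index of their common initial
    stretch. They agree again at \<open>k\<close>, so \<open>Suc i < k\<close>.\<close>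
  define j where "j = (LEAST c. x c \<noteq> y c)"
  have j: "x j \<noteq> y j" "j \<le> k"
    using diff LeastI[of "\<lambda>c. x c \<noteq> y c"] Least_le[of "\<lambda>c. x c \<noteq> y c"]
    by (auto simp: j_def intro: order_trans)
  with ends obtain i where i: "j = Suc i" by (cases j) auto
  have xi: "x i = y i"
    using not_less_Least[of i "\<lambda>c. x c \<noteq> y c"] i by (auto simp: j_def)
  have xi': "x (Suc i) \<noteq> y (Suc i)" and ik: "Suc i < k"
    using j i ends by (auto simp: order_le_less)
  have "0 < k" using ik by simp

  \<comment> \<open>\<open>L\<close> depends only on the last vertex and on the parity of
    \<open>k\<close>. Both spirals share these, so one rule sorts the vertices of both.\<close>
  define L where "L z \<longleftrightarrow> (if even k then z \<le> x k else z < x k)" for z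
  have Lx: "L (x c) \<longleftrightarrow> even c" and Ly: "L (y c) \<longleftrightarrow> even c" if "c \<le> k" for c
    using spiral_left_iff[OF x E that \<open>0 < k\<close>] spiral_left_iff[OF y E that \<open>0 < k\<close>]
    unfolding L_def ends by simp_all
  have sep: "u < v" if "L u" "\<not> L v" for u v
    using that by (auto simp: L_def split: if_splits)
  have inj: "s c \<noteq> s d" if "spiral E k s" "s k = x k" "c < d" "d \<le> k" for s c d
  proof
    assume eq: "s c = s d"
    have "even c = even d"
      using spiral_left_iff[OF that(1) E _ \<open>0 < k\<close>, of c] spiral_left_iff[OF that(1) E _ \<open>0 < k\<close>, of d]
        eq that(3,4) by (metis order.strict_implies_order order.trans)
    then show False
      using spiral_less[OF that(1,3,4)] eq by auto
  qed

  \<comment> \<open>\<open>a\<close> is the first index beyond \<open>i\<close> at which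
    \<open>x\<close> visits a vertex that \<open>y\<close> visits beyond \<open>i\<close>; the
    common end makes \<open>k\<close> a candidate. The index \<open>b\<close> on \<open>y\<close>
    may differ from \<open>a\<close>, but the side of the vertex forces equal parity.\<close>
  define P where "P a \<longleftrightarrow> i < a \<and> a \<le> k \<and> x a \<in> y ` {i<..k}" for a
  define a where "a = (LEAST a. P a)"
  have "P k" using ik ends by (auto simp: P_def)
  then have "P a" unfolding a_def by (rule LeastI)
  then obtain b where ab: "i < a" "a \<le> k" "i < b" "b \<le> k" "x a = y b"
    by (auto simp: P_def)
  have first: "x c \<noteq> y d" if "i < c" "c < a" "i < d" "d \<le> k" for c d
    using not_less_Least[of c P] that ab by (auto simp: P_def a_def)
  have par: "even a = even b"
    using Lx[of a] Ly[of b] ab by simp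
  have not1: "\<not> (a = Suc i \<and> b = Suc i)"
    using ab xi' by auto

  \<comment> \<open>The cycle runs along \<open>x\<close> from where the spirals part to where they first meet again,
    and back along \<open>y\<close>.\<close>
  define n where "n = (a - i) + (b - i)"
  define w where "w t = (if t \<le> a - i then x (i + t) else y (a + b - i - t))" for t
  define vs where "vs = map w [0..<n]"
  have len: "length vs = n" by (simp add: vs_def)
  have w0: "w n = w 0"
    using ab xi by (auto simp: w_def n_def)
  have w_lo: "w t = x (i + t)" if "t \<le> a - i" for t
    using that by (simp add: w_def)
  \<comment> \<open>At \<open>t = a - i\<close> both formulas give the meeting vertex because
    \<open>x a = y b\<close>.\<close>
  have w_hi: "w t = y (a + b - i - t)" if "a - i \<le> t" for t
    using that ab by (cases "t = a - i") (auto simp: w_def)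
  have Lw: "L (w t) \<longleftrightarrow> even (i + t)" if "t \<le> n" for t
  proof (cases "t \<le> a - i")
    case True
    then show ?thesis using Lx[of "i + t"] ab by (simp add: w_lo)
  next
    case False
    have "even (a + b - i - t) = even (i + t)"
      using that par ab by (auto simp: n_def)
    then show ?thesis using False Ly[of "a + b - i - t"] ab by (simp add: w_hi)
  qed
  have edges: "edges (cycle_graph vs) = {{w t, w (Suc t)} | t. t < n}"
    using edges_cycle_graph_map[of w n, OF w0] by (simp add: vs_def)
  have edge_x: "{x c, x (Suc c)} \<in> edges (cycle_graph vs)" if "i \<le> c" "c < a" for c
    unfolding edges using that w_lo[of "c - i"] w_lo[of "Suc (c - i)"] ab
    by (intro CollectI exI[of _ "c - i"]) (auto simp: n_def)
  have edge_y: "{y c, y (Suc c)} \<in> edges (cycle_graph vs)" if "i \<le> c" "c < b" for c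
    unfolding edges using that w_hi[of "a + b - i - Suc c"] w_hi[of "Suc (a + b - i - Suc c)"] ab
    by (intro CollectI exI[of _ "a + b - i - Suc c"]) (auto simp: n_def)
  have edge_cases: "(\<exists>c. i \<le> c \<and> c < a \<and> e = {x c, x (Suc c)}) \<or>
      (\<exists>c. i \<le> c \<and> c < b \<and> e = {y c, y (Suc c)})" if e: "e \<in> edges (cycle_graph vs)" for e
  proof -
    obtain t where t: "t < n" "e = {w t, w (Suc t)}" using e by (auto simp: edges)
    show ?thesis
    proof (cases "t < a - i")
      case True
      then show ?thesis using t w_lo[of t] w_lo[of "Suc t"] ab
        by (intro disjI1 exI[of _ "i + t"]) auto
    next
      case False
      then have "a + b - i - t = Suc (a + b - i - Suc t)" using t by (auto simp: n_def)
      then show ?thesis using False t w_hi[of t] w_hi[of "Suc t"] ab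
        by (intro disjI2 exI[of _ "a + b - i - Suc t"]) (auto simp: n_def)
    qed
  qed
  have set_vs: "z \<in> x ` {i..a} \<union> y ` {i..b}" if z: "z \<in> set vs" for z
  proof -
    obtain t where t: "t < n" "z = w t" using z by (auto simp: vs_def)
    show ?thesis
    proof (cases "t \<le> a - i")
      case True
      then show ?thesis using t w_lo[of t] ab by auto
    next
      case False
      then have "z = y (a + b - i - t)" "a + b - i - t \<in> {i..b}"
        using t w_hi[of t] ab by (auto simp: n_def)
      then show ?thesis by blast
    qed
  qed
  have "w s \<noteq> w t" if st: "s < t" "t < n" for s t
  proof -
    \<comment> \<open>Both positions lie on \<open>x\<close>, or one on each spiral, or both on
      \<open>y\<close>. The mixed case treats \<open>s = 0\<close> apart, since the parting vertex
      belongs to both spirals.\<close>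
    consider "t \<le> a - i" | "s < a - i" "a - i < t" | "a - i \<le> s" by linarith
    then show ?thesis
    proof cases
      case 1
      then show ?thesis using inj[OF x refl, of "i + s" "i + t"] st ab by (simp add: w_lo)
    next
      case 2
      then have "w s = x (i + s)" "w t = y (a + b - i - t)" by (simp_all add: w_lo w_hi)
      moreover have "i < a + b - i - t" "a + b - i - t \<le> k" using st ab 2 by (auto simp: n_def)
      ultimately show ?thesis
        using first[of "i + s" "a + b - i - t"] inj[OF y, of i "a + b - i - t"] 2 xi ends
        by (cases "s = 0") auto
    next
      case 3
      then have "a + b - i - t < a + b - i - s" "a + b - i - s \<le> k"
        using st ab by (auto simp: n_def)
      then show ?thesis
        using inj[OF y, of "a + b - i - t" "a + b - i - s"] 3 st ends by (simp add: w_hi)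
    qed
  qed
  then have dist: "distinct vs"
    by (auto simp: vs_def distinct_map inj_on_def) (metis linorder_neqE_nat)

  have even_n: "even n" using ab par by (auto simp: n_def)
  \<comment> \<open>With \<open>n = 2\<close> both spirals would meet immediately after parting,
    where they differ by the choice of \<open>i\<close>.\<close>
  have "2 \<le> n" "n \<noteq> 2"
    using not1 ab by (auto simp: n_def)
  with even_n have n4: "4 \<le> n"
    by presburger

  have alt: "L (vs ! t) \<noteq> L (vs ! (Suc t mod length vs))" if "t < length vs" for t
  proof -
    have "vs ! (Suc t mod length vs) = w (Suc t)"
      using that w0 n4 by (cases "Suc t = n") (auto simp: vs_def)
    then show ?thesis using that Lw[of t] Lw[of "Suc t"] by (simp add: vs_def)
  qed

  have xmono: "x c \<le> x d" if "even c" "even d" "c \<le> d" "d \<le> k" for c d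
    using spiral_less(1)[OF x, of c d] that by (cases "c = d") auto
  have xanti: "x d \<le> x c" if "odd c" "odd d" "c \<le> d" "d \<le> k" for c d
    using spiral_less(2)[OF x, of c d] that by (cases "c = d") auto
  have ymono: "y c \<le> y d" if "even c" "even d" "c \<le> d" "d \<le> k" for c d
    using spiral_less(1)[OF y, of c d] that by (cases "c = d") auto
  have yanti: "y d \<le> y c" if "odd c" "odd d" "c \<le> d" "d \<le> k" for c d
    using spiral_less(2)[OF y, of c d] that by (cases "c = d") auto

  \<comment> \<open>With a position and a side for each cycle vertex, extremality reduces to
    monotonicity along a single spiral.\<close>
  have vertex: "\<exists>c\<ge>i. (c \<le> a \<and> z = x c \<or> c \<le> b \<and> z = y c) \<and> (L z \<longleftrightarrow> even c)"
    if "z \<in> set vs" for z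
  proof -
    from set_vs[OF that] obtain c where "i \<le> c" "c \<le> a \<and> z = x c \<or> c \<le> b \<and> z = y c"
      by auto
    then show ?thesis
      using Lx[of c] Ly[of c] ab by (intro exI[of _ c]) auto
  qed

  \<comment> \<open>Outer border: \<open>x i\<close> is extreme on its side. Vertices on the other
    side have index at least \<open>Suc i\<close>, so the extreme one there is
    \<open>x (Suc i)\<close> or \<open>y (Suc i)\<close>.\<close>
  have "\<exists>p q. {p, q} \<in> edges (cycle_graph vs) \<and> L p \<and> \<not> L q \<and>
      (\<forall>z\<in>set vs. (L z \<longrightarrow> p \<le> z) \<and> (\<not> L z \<longrightarrow> z \<le> q))"
  proof -
    let ?X = "x (Suc i)" and ?Y = "y (Suc i)"
    note sides = Lx[of i] Lx[of "Suc i"] Ly[of "Suc i"]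
    have e: "{x i, ?X} \<in> edges (cycle_graph vs)" "{x i, ?Y} \<in> edges (cycle_graph vs)"
      using edge_x[of i] edge_y[of i] ab xi by auto
    show ?thesis
    proof (cases "even i")
      case True
      have lo: "x i \<le> z" if z: "z \<in> set vs" "L z" for z
      proof -
        obtain c where c: "i \<le> c" "c \<le> a \<and> z = x c \<or> c \<le> b \<and> z = y c" "even c"
          using vertex[OF z(1)] z(2) by blast
        with c show ?thesis
          using xmono[of i c] ymono[of i c] True xi ab by (auto simp: min_le_iff_disj le_max_iff_disj)
      qed
      have hi: "z \<le> max ?X ?Y" if z: "z \<in> set vs" "\<not> L z" for z
      proof -
        obtain c where c: "i \<le> c" "c \<le> a \<and> z = x c \<or> c \<le> b \<and> z = y c" "odd c"
          using vertex[OF z(1)] z(2) by blast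
        then have "Suc i \<le> c"
          using True by (cases "c = i") auto
        with c show ?thesis
          using xanti[of "Suc i" c] yanti[of "Suc i" c] True ab by (auto simp: min_le_iff_disj le_max_iff_disj)
      qed
      show ?thesis
        using e lo hi sides True ik
        by (intro exI[of _ "x i"] exI[of _ "max ?X ?Y"]) (auto simp: max_def)
    next
      case False
      have hi: "z \<le> x i" if z: "z \<in> set vs" "\<not> L z" for z
      proof -
        obtain c where c: "i \<le> c" "c \<le> a \<and> z = x c \<or> c \<le> b \<and> z = y c" "odd c"
          using vertex[OF z(1)] z(2) by blast
        with c show ?thesis
          using xanti[of i c] yanti[of i c] False xi ab by (auto simp: min_le_iff_disj le_max_iff_disj)
      qed
      have lo: "min ?X ?Y \<le> z" if z: "z \<in> set vs" "L z" for z
      proof -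
        obtain c where c: "i \<le> c" "c \<le> a \<and> z = x c \<or> c \<le> b \<and> z = y c" "even c"
          using vertex[OF z(1)] z(2) by blast
        then have "Suc i \<le> c"
          using False by (cases "c = i") auto
        with c show ?thesis
          using xmono[of "Suc i" c] ymono[of "Suc i" c] False ab by (auto simp: min_le_iff_disj le_max_iff_disj)
      qed
      show ?thesis
        using e lo hi sides False ik
        by (intro exI[of _ "min ?X ?Y"] exI[of _ "x i"]) (auto simp: min_def insert_commute)
    qed
  qed
  then obtain p q where outer: "{p, q} \<in> edges (cycle_graph vs)" "L p" "\<not> L q"
      "\<And>z. z \<in> set vs \<Longrightarrow> L z \<Longrightarrow> p \<le> z" "\<And>z. z \<in> set vs \<Longrightarrow> \<not> L z \<Longrightarrow> z \<le> q"
    by blast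

  \<comment> \<open>Inner border: the mirror image at \<open>x a = y b\<close>, with the two
    predecessors \<open>x a'\<close> and \<open>y b'\<close> as candidates on the other
    side.\<close>
  have "\<exists>p q. {p, q} \<in> edges (cycle_graph vs) \<and> L p \<and> \<not> L q \<and>
      (\<forall>z\<in>set vs. (L z \<longrightarrow> z \<le> p) \<and> (\<not> L z \<longrightarrow> q \<le> z))"
  proof -
    obtain a' b' where a': "a = Suc a'" and b': "b = Suc b'"
      using ab by (cases a; cases b) auto
    let ?X = "x a'" and ?Y = "y b'"
    note sides = Lx[of a] Lx[of a'] Ly[of b']
    have e: "{?X, x a} \<in> edges (cycle_graph vs)" "{?Y, x a} \<in> edges (cycle_graph vs)"
      using edge_x[of a'] edge_y[of b'] ab a' b' by auto
    show ?thesis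
    proof (cases "even a")
      case True
      have hi: "z \<le> x a" if z: "z \<in> set vs" "L z" for z
      proof -
        obtain c where c: "i \<le> c" "c \<le> a \<and> z = x c \<or> c \<le> b \<and> z = y c" "even c"
          using vertex[OF z(1)] z(2) by blast
        with c show ?thesis
          using xmono[of c a] ymono[of c b] True par ab by (auto simp: min_le_iff_disj le_max_iff_disj)
      qed
      have lo: "min ?X ?Y \<le> z" if z: "z \<in> set vs" "\<not> L z" for z
      proof -
        obtain c where c: "i \<le> c" "c \<le> a \<and> z = x c \<or> c \<le> b \<and> z = y c" "odd c"
          using vertex[OF z(1)] z(2) by blast
        then have "c \<le> a' \<and> z = x c \<or> c \<le> b' \<and> z = y c"
          using True a' b' par by (auto simp: le_Suc_eq)
        with c show ?thesis
          using xanti[of c a'] yanti[of c b'] True a' b' par ab by (auto simp: min_le_iff_disj le_max_iff_disj)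
      qed
      show ?thesis
        using e lo hi sides True ab a' b' par
        by (intro exI[of _ "x a"] exI[of _ "min ?X ?Y"]) (auto simp: min_def insert_commute)
    next
      case False
      have lo: "x a \<le> z" if z: "z \<in> set vs" "\<not> L z" for z
      proof -
        obtain c where c: "i \<le> c" "c \<le> a \<and> z = x c \<or> c \<le> b \<and> z = y c" "odd c"
          using vertex[OF z(1)] z(2) by blast
        with c show ?thesis
          using xanti[of c a] yanti[of c b] False par ab by (auto simp: min_le_iff_disj le_max_iff_disj)
      qed
      have hi: "z \<le> max ?X ?Y" if z: "z \<in> set vs" "L z" for z
      proof -
        obtain c where c: "i \<le> c" "c \<le> a \<and> z = x c \<or> c \<le> b \<and> z = y c" "even c"
          using vertex[OF z(1)] z(2) by blast
        then have "c \<le> a' \<and> z = x c \<or> c \<le> b' \<and> z = y c"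
          using False a' b' par by (auto simp: le_Suc_eq)
        with c show ?thesis
          using xmono[of c a'] ymono[of c b'] False a' b' par ab by (auto simp: min_le_iff_disj le_max_iff_disj)
      qed
      show ?thesis
        using e lo hi sides False ab a' b' par
        by (intro exI[of _ "max ?X ?Y"] exI[of _ "x a"]) (auto simp: max_def)
    qed
  qed
  then obtain p' q' where inner: "{p', q'} \<in> edges (cycle_graph vs)" "L p'" "\<not> L q'"
      "\<And>z. z \<in> set vs \<Longrightarrow> L z \<Longrightarrow> z \<le> p'" "\<And>z. z \<in> set vs \<Longrightarrow> \<not> L z \<Longrightarrow> q' \<le> z"
    by blast

  have "edges (cycle_graph vs) \<subseteq> {{u, v} | u v. (u, v) \<in> E}"
  proof
    fix e assume "e \<in> edges (cycle_graph vs)"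
    then obtain s c where s: "spiral E k s" "c < k" "e = {s c, s (Suc c)}"
      using edge_cases x y ab by (metis order_less_le_trans)
    show "e \<in> {{u, v} | u v. (u, v) \<in> E}"
      using spiral_edge[OF s(1,2)] s(3) by (cases "even c") (auto simp: insert_commute)
  qed
  moreover have "bordered_cycle (cycle_graph vs)"
    using bordered_cycle_cycle_graph[of vs L p q p' q', OF dist _ alt sep outer inner] n4 len by simp
  moreover have "n \<le> 2 * k"
    using ab by (auto simp: n_def)
  ultimately show ?thesis
    using that[of vs] dist even_n n4 len by simp
qed

subsection \<open>Counting nested paths\<close>

text \<open>Both ends are tested because a spiral may continue at either one. The counts refer to
  the untrimmed \<open>E\<close>, which is where the continuations are sought.\<close>

definition trim :: "nat \<Rightarrow> ('a::linorder \<times> 'a) set \<Rightarrow> ('a \<times> 'a) set" where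
  "trim d E = {(u, v) \<in> E. d \<le> card {w. (u, w) \<in> E \<and> w < v} \<and> d \<le> card {w. (w, v) \<in> E \<and> u < w}}"

text \<open>The number of smaller elements is an injective rank, and only \<open>d\<close> ranks lie
  below \<open>d\<close>.\<close>

lemma card_few_below:
  fixes N :: "'a::linorder set"
  assumes "finite N"
  shows "card {v \<in> N. card {w \<in> N. w < v} < d} \<le> d"
proof -
  have mono: "card {w \<in> N. w < u} < card {w \<in> N. w < v}" if "u \<in> N" "u < v" for u v
    using that assms by (intro psubset_card_mono) auto
  have "inj_on (\<lambda>v. card {w \<in> N. w < v}) N"
    by (rule linorder_inj_onI) (use mono in fastforce)+
  then have "inj_on (\<lambda>v. card {w \<in> N. w < v}) {v \<in> N. card {w \<in> N. w < v} < d}"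
    by (rule inj_on_subset) auto
  then have "card {v \<in> N. card {w \<in> N. w < v} < d} \<le> card {..<d}"
    by (rule card_inj_on_le) auto
  then show ?thesis by simp
qed

lemma card_few_above:
  fixes N :: "'a::linorder set"
  assumes "finite N"
  shows "card {v \<in> N. card {w \<in> N. v < w} < d} \<le> d"
proof -
  have mono: "card {w \<in> N. v < w} < card {w \<in> N. u < w}" if "v \<in> N" "u < v" for u v
    using that assms by (intro psubset_card_mono) auto
  have "inj_on (\<lambda>v. card {w \<in> N. v < w}) N"
    by (rule linorder_inj_onI) (use mono in fastforce)+
  then have "inj_on (\<lambda>v. card {w \<in> N. v < w}) {v \<in> N. card {w \<in> N. v < w} < d}"
    by (rule inj_on_subset) auto
  then have "card {v \<in> N. card {w \<in> N. v < w} < d} \<le> card {..<d}"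
    by (rule card_inj_on_le) auto
  then show ?thesis by simp
qed

text \<open>Each vertex loses at most \<open>d\<close> edges as a left end and at most
  \<open>d\<close> as a right end.\<close>

lemma card_trim:
  assumes V: "finite V" "E \<subseteq> V \<times> V"
  shows "card E \<le> card (trim d E) + 2 * card V * d"
proof -
  have finE: "finite E" using V finite_subset by blast
  have fin: "finite {w. (u, w) \<in> E}" "finite {w. (w, u) \<in> E}" for u
    using V by (auto intro: finite_subset[of _ V])
  define A where "A = (SIGMA u:V. {v \<in> {w. (u, w) \<in> E}. card {w \<in> {w. (u, w) \<in> E}. w < v} < d})"
  \<comment> \<open>\<open>B\<close> lists the right end first so that it can be counted over right
    ends; \<open>prod.swap\<close> restores the orientation later.\<close>
  define B where "B = (SIGMA v:V. {u \<in> {w. (w, v) \<in> E}. card {w \<in> {w. (w, v) \<in> E}. u < w} < d})"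
  have "card A = (\<Sum>u\<in>V. card {v \<in> {w. (u, w) \<in> E}. card {w \<in> {w. (u, w) \<in> E}. w < v} < d})"
    unfolding A_def using V fin by (intro card_SigmaI) auto
  also have "\<dots> \<le> (\<Sum>u\<in>V. d)"
    by (intro sum_mono card_few_below fin)
  finally have A: "card A \<le> card V * d" by simp
  have "card B = (\<Sum>v\<in>V. card {u \<in> {w. (w, v) \<in> E}. card {w \<in> {w. (w, v) \<in> E}. u < w} < d})"
    unfolding B_def using V fin by (intro card_SigmaI) auto
  also have "\<dots> \<le> (\<Sum>v\<in>V. d)"
    by (intro sum_mono card_few_above fin)
  finally have B: "card B \<le> card V * d" by simp
  have finAB: "finite A" "finite B" using V fin by (auto simp: A_def B_def)
  have "E \<subseteq> trim d E \<union> (A \<union> prod.swap ` B)"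
  proof (rule subrelI)
    fix u v assume "(u, v) \<in> E"
    moreover from this have "u \<in> V" "v \<in> V" using V by auto
    ultimately show "(u, v) \<in> trim d E \<union> (A \<union> prod.swap ` B)"
      by (auto simp: trim_def A_def B_def not_le intro!: image_eqI[of "(u, v)" _ "(v, u)"])
  qed
  then have "card E \<le> card (trim d E \<union> (A \<union> prod.swap ` B))"
    using finAB finE by (intro card_mono) (auto simp: trim_def intro: finite_subset[of _ E])
  also have "\<dots> \<le> card (trim d E) + (card A + card B)"
    by (meson add_left_mono card_Un_le card_image_le finAB order_trans add_mono le_refl)
  finally show ?thesis using A B by simp
qed

text \<open>Spirals are stored as lists with the innermost vertex first; \<open>F i\<close> is the set
  from which the edge number \<open>i\<close>, counted from the outside, is taken.\<close>

primrec spirals :: "(nat \<Rightarrow> ('a::linorder \<times> 'a) set) \<Rightarrow> nat \<Rightarrow> 'a list set" where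
  "spirals F 0 = (\<lambda>(u, v). [v, u]) ` F 0"
| "spirals F (Suc m) = (\<lambda>(l, z). z # l) `
     (SIGMA l:spirals F m. {z. if even m then (z, l ! 0) \<in> F (Suc m) \<and> l ! 1 < z
                               else (l ! 0, z) \<in> F (Suc m) \<and> z < l ! 1})"

lemma spirals_length: "l \<in> spirals F m \<Longrightarrow> length l = Suc (Suc m)"
  by (induction m arbitrary: l) auto

lemma spirals_last_edge:
  "l \<in> spirals F m \<Longrightarrow> (if even m then (l ! 1, l ! 0) \<in> F m else (l ! 0, l ! 1) \<in> F m)"
  by (cases m) (auto split: if_splits)

lemma spirals_spiral:
  assumes "\<And>i. i \<le> m \<Longrightarrow> F i \<subseteq> E" and "l \<in> spirals F m"
  shows "spiral E (Suc m) (\<lambda>c. rev l ! c)"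
  using assms
proof (induction m arbitrary: l)
  case 0
  then show ?case by (auto simp: spiral_def)
next
  case (Suc m)
  obtain l' z where l: "l = z # l'" "l' \<in> spirals F m"
    and z: "if even m then (z, l' ! 0) \<in> F (Suc m) \<and> l' ! 1 < z
            else (l' ! 0, z) \<in> F (Suc m) \<and> z < l' ! 1"
    using Suc.prems(2) by auto
  have IH: "spiral E (Suc m) (\<lambda>c. rev l' ! c)"
    using Suc.IH[OF _ l(2)] Suc.prems(1) by auto
  have len: "length l' = Suc (Suc m)" using spirals_length[OF l(2)] .
  have old: "rev l ! c = rev l' ! c" if "c < Suc (Suc m)" for c
    using that len by (simp add: l nth_append)
  have new: "rev l ! Suc (Suc m) = z" "rev l' ! Suc m = l' ! 0" "rev l' ! m = l' ! 1"
    using len by (simp_all add: l nth_append rev_nth)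
  have zE: "if even m then (z, l' ! 0) \<in> E \<and> l' ! 1 < z else (l' ! 0, z) \<in> E \<and> z < l' ! 1"
    using z Suc.prems(1)[of "Suc m"] by (auto split: if_splits)
  show ?case
    unfolding spiral_def
  proof (intro conjI allI impI)
    fix c assume c: "c < Suc (Suc m)"
    show "if even c then (rev l ! c, rev l ! Suc c) \<in> E else (rev l ! Suc c, rev l ! c) \<in> E"
    proof (cases "c = Suc m")
      case True
      then show ?thesis using zE old[of c] new by (auto split: if_splits)
    next
      case False
      then show ?thesis using c spiral_edge[OF IH, of c] old[of c] old[of "Suc c"] by auto
    qed
  next
    fix c assume c: "Suc (Suc c) \<le> Suc (Suc m)"
    show "if even c then rev l ! c < rev l ! Suc (Suc c) else rev l ! Suc (Suc c) < rev l ! c"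
    proof (cases "c = m")
      case True
      then show ?thesis using zE old[of c] new by (auto split: if_splits)
    next
      case False
      then show ?thesis using c spiral_step[OF IH, of c] old[of c] old[of "Suc (Suc c)"] by auto
    qed
  qed
qed

text \<open>The innermost edge of a spiral lies in \<open>F m\<close>, hence survives the trimming
  of \<open>F (Suc m)\<close>, and this leaves at least \<open>d\<close> choices for the next
  vertex.\<close>

lemma card_spirals:
  assumes fin: "\<And>i. finite (F i)" and trim: "\<And>i. i < m \<Longrightarrow> F i \<subseteq> trim d (F (Suc i))"
  shows "finite (spirals F m) \<and> card (F 0) * d ^ m \<le> card (spirals F m)"
  using trim
proof (induction m)
  case 0
  have "card ((\<lambda>(u, v). [v, u]) ` F 0) = card (F 0)"
    by (intro card_image) (auto simp: inj_on_def)
  then show ?case using fin by simp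
next
  case (Suc m)
  define ext where "ext l = {z. if even m then (z, l ! 0) \<in> F (Suc m) \<and> l ! 1 < z
                               else (l ! 0, z) \<in> F (Suc m) \<and> z < l ! 1}" for l
  have eq: "spirals F (Suc m) = (\<lambda>(l, z). z # l) ` (SIGMA l:spirals F m. ext l)"
    by (simp add: ext_def)
  have fext: "finite (ext l)" for l
    by (rule finite_subset[of _ "fst ` F (Suc m) \<union> snd ` F (Suc m)"])
      (use fin in \<open>force simp: ext_def split: if_splits\<close>)+
  have dext: "d \<le> card (ext l)" if "l \<in> spirals F m" for l
    using spirals_last_edge[OF that] Suc.prems[of m]
    by (auto simp: ext_def trim_def split: if_splits)
  have IH: "finite (spirals F m)" "card (F 0) * d ^ m \<le> card (spirals F m)"
    using Suc by auto
  have "card (F 0) * d ^ Suc m \<le> card (spirals F m) * d"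
    using mult_le_mono1[OF IH(2), of d] by (simp add: ac_simps)
  also have "\<dots> \<le> (\<Sum>l\<in>spirals F m. card (ext l))"
    using sum_mono[of "spirals F m" "\<lambda>_. d"] dext by simp
  also have "\<dots> = card (spirals F (Suc m))"
    unfolding eq using IH(1) fext by (subst card_image) (auto simp: inj_on_def)
  finally show ?case
    using IH(1) fext by (simp add: eq del: spirals.simps)
qed

lemma card_trim_iterate:
  assumes V: "finite V" "E \<subseteq> V \<times> V"
  shows "(trim d ^^ m) E \<subseteq> E \<and> card E \<le> card ((trim d ^^ m) E) + m * (2 * card V * d)"
proof (induction m)
  case (Suc m)
  have "trim d ((trim d ^^ m) E) \<subseteq> (trim d ^^ m) E"
    by (auto simp: trim_def)
  moreover have "(trim d ^^ m) E \<subseteq> V \<times> V"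
    using Suc V by blast
  ultimately show ?case
    using Suc card_trim[OF V(1), of "(trim d ^^ m) E" d] by auto
qed auto

text \<open>Pigeonhole on the pairs of end vertices: without the forbidden cycles, a spiral is
  determined by its ends. The bound on \<open>d\<close> keeps the loss from all trimmings below half
  of \<open>E\<close>.\<close>

lemma card_edges_spirals:
  fixes E :: "('a::linorder \<times> 'a) set"
  assumes V: "finite V" "E \<subseteq> V \<times> V" and less: "\<And>u v. (u, v) \<in> E \<Longrightarrow> u < v" and "0 < k"
    and free: "\<And>vs. \<lbrakk>bordered_cycle (cycle_graph vs); distinct vs; even (length vs); 4 \<le> length vs;
      length vs \<le> 2 * k; edges (cycle_graph vs) \<subseteq> {{u, v} | u v. (u, v) \<in> E}\<rbrakk> \<Longrightarrow> False"
    and d: "4 * k * card V * d \<le> card E"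
  shows "card E * d ^ (k - 1) \<le> 2 * card V ^ 2"
proof -
  obtain m where k: "k = Suc m" using \<open>0 < k\<close> by (cases k) auto
  \<comment> \<open>The indices run against the trimming: \<open>F m\<close> is \<open>E\<close>,
    while outermost edges come from \<open>F 0\<close>, which has been trimmed \<open>m\<close>
    times.\<close>
  define F where "F i = (trim d ^^ (m - i)) E" for i
  have FE: "F i \<subseteq> E" for i
    using card_trim_iterate[OF V] by (simp add: F_def)
  have finE: "finite E" using V finite_subset by blast
  have finF: "finite (F i)" for i
    using FE finE finite_subset by blast
  have step: "F i \<subseteq> trim d (F (Suc i))" if "i < m" for i
  proof -
    have "m - i = Suc (m - Suc i)" using that by simp
    then show ?thesis unfolding F_def by simp
  qed
  have W: "finite (spirals F m)" "card (F 0) * d ^ m \<le> card (spirals F m)"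
    using card_spirals[of F m d, OF finF step] by auto
  have inV: "set l \<subseteq> V" if "l \<in> spirals F i" "i \<le> m" for l i
    using that
  proof (induction i arbitrary: l)
    case 0
    then show ?case using FE V by fastforce
  next
    case (Suc i)
    then show ?case using FE[of "Suc i"] V by (fastforce split: if_splits)
  qed
  have "inj_on (\<lambda>l. (rev l ! 0, rev l ! k)) (spirals F m)"
  proof (rule inj_onI, rule ccontr)
    fix l l' assume l: "l \<in> spirals F m" "l' \<in> spirals F m"
      and eq: "(rev l ! 0, rev l ! k) = (rev l' ! 0, rev l' ! k)" and "l \<noteq> l'"
    have len: "length (rev l) = Suc k" "length (rev l') = Suc k"
      using l spirals_length k by auto
    moreover have "rev l \<noteq> rev l'" using \<open>l \<noteq> l'\<close> by simp
    ultimately have "\<exists>c\<le>k. rev l ! c \<noteq> rev l' ! c"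
      using nth_equalityI[of "rev l" "rev l'"] by (auto simp: less_Suc_eq_le)
    then show False
      using spirals_bordered_cycle[of E k "\<lambda>c. rev l ! c" "\<lambda>c. rev l' ! c"] less free eq
        spirals_spiral[of m F E, OF FE l(1)] spirals_spiral[of m F E, OF FE l(2)] k by blast
  qed
  moreover have "(\<lambda>l. (rev l ! 0, rev l ! k)) ` spirals F m \<subseteq> V \<times> V"
  proof safe
    fix l assume l: "l \<in> spirals F m"
    have "length (rev l) = Suc k" using spirals_length[OF l] k by simp
    then have "rev l ! 0 \<in> set (rev l)" "rev l ! k \<in> set (rev l)"
      using nth_mem[of 0 "rev l"] nth_mem[of k "rev l"] by simp_all
    then show "rev l ! 0 \<in> V" "rev l ! k \<in> V"
      using inV[OF l] by auto
  qed
  ultimately have "card (spirals F m) \<le> card (V \<times> V)"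
    using V by (intro card_inj_on_le) auto
  then have "card (F 0) * d ^ m \<le> card V ^ 2"
    using W by (simp add: card_cartesian_product power2_eq_square)
  moreover have "card E \<le> 2 * card (F 0)"
  proof -
    have "card E \<le> card (F 0) + m * (2 * card V * d)"
      using card_trim_iterate[OF V, of m d] by (simp add: F_def)
    moreover have "2 * (m * (2 * card V * d)) \<le> 4 * k * card V * d"
      by (simp add: k algebra_simps)
    ultimately show ?thesis using d by linarith
  qed
  then have "card E * d ^ m \<le> 2 * card (F 0) * d ^ m"
    by (rule mult_le_mono1)
  ultimately show ?thesis
    unfolding k diff_Suc_1 by linarith
qed

section \<open>The upper bound for ordered graphs\<close>

lemma ordered_graph_edge:
  assumes "ordered_graph G" "e \<in> edges G"
  obtains u v where "e = {u, v}" "u < v" "u \<in> verts G" "v \<in> verts G"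
proof -
  have "card e = 2" "e \<subseteq> verts G" using assms by (auto simp: ordered_graph_def)
  then obtain u v where "e = {u, v}" "u \<noteq> v" by (auto simp: card_2_iff)
  with \<open>e \<subseteq> verts G\<close> show ?thesis
    using that[of u v] that[of v u] by (cases "u < v") (auto simp: insert_commute)
qed

text \<open>Let \<open>r\<close> be the \<open>k\<close>-th root of \<open>n\<close>. If the bound
  failed, \<open>d\<close> would be at least \<open>r\<close>, and the number of edges times
  \<open>d ^ (k - 1)\<close> would exceed \<open>8 * k * n ^ 2\<close>, whereas counting spirals
  allows only \<open>2 * n ^ 2\<close>.\<close>

lemma card_edges_free_le:
  fixes G :: "nat ograph"
  assumes G: "ordered_graph G" "card (verts G) = n" and "0 < k" "0 < n"
    and free: "\<forall>H \<in> (\<Union>j \<in> {2..k}. bordered_cycles (2 * j)). \<not> contains_ograph G H"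
  shows "real (card (edges G)) \<le> 8 * real k * real n powr (1 + 1 / real k)"
proof -
  define V where "V = verts G"
  define E where "E = {(u, v). u < v \<and> {u, v} \<in> edges G}"
  have finV: "finite V" using G by (simp add: V_def ordered_graph_def)
  have EV: "E \<subseteq> V \<times> V"
    using G by (auto simp: E_def V_def ordered_graph_def)
  have "edges G = (\<lambda>(u, v). {u, v}) ` E"
    by (auto simp: E_def image_iff) (metis G(1) ordered_graph_edge)
  moreover have "inj_on (\<lambda>(u, v). {u, v}) E"
    by (auto simp: inj_on_def E_def doubleton_eq_iff)
  ultimately have cE: "card (edges G) = card E"
    by (simp add: card_image)
  have noc: False
    if vs: "bordered_cycle (cycle_graph vs)" "distinct vs" "even (length vs)" "4 \<le> length vs"
      "length vs \<le> 2 * k" "edges (cycle_graph vs) \<subseteq> {{u, v} | u v. (u, v) \<in> E}" for vs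
  proof -
    obtain j where j: "length vs = 2 * j" using vs(3) by blast
    have "cycle_graph vs \<in> (\<Union>j \<in> {2..k}. bordered_cycles (2 * j))"
      using vs j by (auto simp: bordered_cycles_def distinct_card)
    moreover have "contains_ograph G (cycle_graph vs)"
    proof -
      have sub: "edges (cycle_graph vs) \<subseteq> edges G" using vs(6) by (auto simp: E_def)
      moreover have "set vs \<subseteq> verts G"
      proof
        fix z assume "z \<in> set vs"
        then obtain i where "i < length vs" "z = vs ! i" by (auto simp: in_set_conv_nth)
        then have "\<exists>e\<in>edges (cycle_graph vs). z \<in> e" by (auto simp: edges_cycle_graph)
        then show "z \<in> verts G" using sub G by (auto simp: ordered_graph_def)
      qed
      ultimately show ?thesis
        unfolding contains_ograph_def by (intro exI[of _ "\<lambda>z. z"]) (auto intro: mono_onI)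
    qed
    ultimately show False using free by blast
  qed
  have cV: "card V = n" using G by (simp add: V_def)
  \<comment> \<open>The largest value that the hypothesis of \<open>card_edges_spirals\<close>
    permits.\<close>
  define d where "d = card E div (4 * k * n)"
  have "4 * k * card V * d \<le> card E"
    by (simp add: d_def cV)
  then have main: "card E * d ^ (k - 1) \<le> 2 * n ^ 2"
    using card_edges_spirals[OF finV EV _ \<open>0 < k\<close> noc] cV by (auto simp: E_def)
  define r where "r = real n powr (1 / real k)"
  have r: "r ^ k = real n" "1 \<le> r"
    using \<open>0 < k\<close> \<open>0 < n\<close> by (auto simp: r_def powr_realpow[symmetric] powr_powr ge_one_powr_ge_zero)
  have "real (card E) \<le> 8 * real k * (real n * r)"
  proof (rule ccontr)
    assume "\<not> ?thesis"
    then have big: "8 * real k * real n * r < real (card E)" by simp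
    have pos: "0 < real k * real n" using \<open>0 < k\<close> \<open>0 < n\<close> by simp
    have "real (card E) < real (4 * k * n) * (real d + 1)"
    proof -
      have "card E < 4 * k * n * Suc d"
        unfolding d_def using \<open>0 < k\<close> \<open>0 < n\<close> dividend_less_times_div[of "4 * k * n" "card E"]
        by (simp add: algebra_simps)
      then have "real (card E) < real (4 * k * n * Suc d)" by (simp only: of_nat_less_iff)
      then show ?thesis by (simp add: algebra_simps)
    qed
    with big have "4 * (real k * real n) * (2 * r) < 4 * (real k * real n) * (real d + 1)"
      by (simp add: algebra_simps)
    then have "2 * r < real d + 1"
      by (rule mult_left_less_imp_less) (use pos in simp)
    \<comment> \<open>The spare factor 2 absorbs the rounding of the integer division.\<close>
    then have dr: "r \<le> real d" using r(2) by linarith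
    have "8 * real k * real n * real n \<le> 8 * real k * real n * (r * r ^ (k - 1))"
      using r(1) \<open>0 < k\<close> by (cases k) auto
    also have "\<dots> = (8 * real k * real n * r) * r ^ (k - 1)" by simp
    also have "\<dots> < real (card E) * r ^ (k - 1)"
      using big r(2) by (intro mult_strict_right_mono) auto
    also have "\<dots> \<le> real (card E) * real d ^ (k - 1)"
      using dr r(2) by (intro mult_left_mono power_mono) auto
    also have "\<dots> \<le> 2 * real n ^ 2"
      using of_nat_mono[OF main, where 'a = real] by simp
    finally have "(8 * real k) * (real n * real n) < 2 * (real n * real n)"
      by (simp add: power2_eq_square)
    then have "8 * real k < 2" using \<open>0 < n\<close> by simp
    then show False using \<open>0 < k\<close> by simp
  qed
  also have "real n * r = real n powr (1 + 1 / real k)"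
    using \<open>0 < n\<close> by (simp add: powr_add r_def)
  finally show ?thesis by (simp add: cE)
qed

subsection \<open>Primes in geometric intervals\<close>

text \<open>Supplies a lower bound for the least common multiple. In the middle of a row, the factor
  \<open>m\<close> cancels, up to a factor 2, the denominator in the standard estimate of the
  central binomial coefficient.\<close>

lemma mult_binomial_dvd_Lcm:
  assumes "1 \<le> m" "m \<le> n"
  shows "m * (n choose m) dvd Lcm {1..n}"
  using assms
proof (induction m arbitrary: n rule: dec_induct)
  case base
  then show ?case by (auto intro: dvd_Lcm)
next
  case (step m)
  obtain n' where n: "n = Suc n'" "m \<le> n'" using step.prems by (cases n) auto
  \<comment> \<open>Integers are used because the recurrence subtracts the cofactors
    \<open>q1\<close> and \<open>q2\<close>.\<close>
  define D where "D = int (Lcm {1..n})"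
  have "Lcm {1..n'} dvd Lcm {1..n}"
    by (rule Lcm_subset) (auto simp: n)
  then have "m * (n' choose m) dvd Lcm {1..n}" "m * (n choose m) dvd Lcm {1..n}"
    using step.IH[of n'] step.IH[of n] n by (auto intro: dvd_trans)
  then obtain q1 q2 where "Lcm {1..n} = m * (n' choose m) * q1" "Lcm {1..n} = m * (n choose m) * q2"
    by (elim dvdE) blast
  then have D1: "D = int m * int (n' choose m) * int q1" and D2: "D = int m * int (n choose m) * int q2"
    unfolding D_def by (metis of_nat_mult)+
  have nm: "int n - int m = int (n - m)"
    using n by simp
  have "(n - m) * (n choose m) = n * (n' choose m)"
    using binomial_absorb_comp[of n m] n by simp
  then have "int ((n - m) * (n choose m)) = int (n * (n' choose m))"
    by simp
  then have eq: "(int n - int m) * int (n choose m) = int n * int (n' choose m)"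
    by (simp only: nm of_nat_mult)
  have "(n - m) * (n choose m) = Suc m * (n choose Suc m)"
    using binomial_absorption[of m n] binomial_absorb_comp[of n m] by simp
  then have "int ((n - m) * (n choose m)) = int (Suc m * (n choose Suc m))"
    by simp
  then have eq': "(int n - int m) * int (n choose m) = int (Suc m * (n choose Suc m))"
    by (simp only: nm of_nat_mult)
  text \<open>Leibniz' harmonic triangle: the reciprocals of the numbers \<open>m * (n choose m)\<close> satisfy
    the recurrence \<open>L n (m + 1) = L (n - 1) m - L n m\<close>.\<close>
  have "int m * (int (Suc m * (n choose Suc m)) * (int q1 - int q2)) =
      int n * (int m * int (n' choose m) * int q1) - (int n - int m) * (int m * int (n choose m) * int q2)"
    using eq eq' by algebra
  also have "\<dots> = int m * D"
    unfolding D1[symmetric] D2[symmetric] by (simp add: algebra_simps)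
  finally have "D = int (Suc m * (n choose Suc m)) * (int q1 - int q2)"
    using step.hyps by simp
  then have "int (Suc m * (n choose Suc m)) dvd int (Lcm {1..n})"
    unfolding D_def[symmetric] by (rule dvdI)
  then show ?case
    by (simp only: int_dvd_int_iff)
qed

text \<open>The multiplicity of a prime in a least common multiple is the maximum over the
  arguments, so the prime power already divides one number up to \<open>N\<close>.\<close>

lemma prime_power_dvd_Lcm_le:
  fixes p :: nat
  assumes "prime p" "1 \<le> N" "p ^ e dvd Lcm {1..N}"
  shows "p ^ e \<le> N"
  using assms(2,3)
proof (induction N rule: dec_induct)
  case base
  then show ?case by auto
next
  case (step N)
  have np: "\<not> is_unit p" using assms(1) by (metis not_prime_unit)
  have nz: "Lcm {1..N} \<noteq> 0" by (simp add: Lcm_0_iff)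
  have "{1..Suc N} = insert (Suc N) {1..N}" by auto
  then have "p ^ e dvd lcm (Suc N) (Lcm {1..N})"
    using step.prems by (simp del: One_nat_def)
  then have "p ^ e dvd Suc N \<or> p ^ e dvd Lcm {1..N}"
    using assms(1) np nz by (auto simp: power_dvd_iff_le_multiplicity multiplicity_lcm)
  then show ?case
    using step.IH by (auto dest: dvd_imp_le)
qed

lemma prod_primes_dvd:
  fixes n :: nat
  assumes "finite S" "\<And>p. p \<in> S \<Longrightarrow> prime p \<and> p dvd n"
  shows "\<Prod>S dvd n"
  using assms
proof (induction S)
  case (insert p S)
  have "coprime p (\<Prod>S)"
    using insert by (intro prod_coprime_right) (auto intro!: primes_coprime)
  then show ?case using insert by (auto intro: divides_mult)
qed auto

text \<open>With \<open>n = 2 ^ r\<close>, the primes above \<open>n\<close> and up to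
  \<open>2 * n\<close> divide the central binomial coefficient, which is at most
  \<open>4 ^ n\<close>. Powers of two make each induction step one doubling.\<close>

lemma primorial_le: "\<Prod>{p::nat. prime p \<and> p \<le> 2 ^ r} \<le> 4 ^ (2 ^ r)"
proof (induction r)
  case 0
  have *: "{p::nat. prime p \<and> p \<le> 2 ^ 0} = {}"
    by (auto dest: prime_gt_1_nat)
  show ?case unfolding * by simp
next
  case (Suc r)
  define n where "n = (2::nat) ^ r"
  define S where "S = {p. prime p \<and> n < p \<and> p \<le> 2 * n}"
  have "\<Prod>S dvd (2 * n choose n)"
  proof (rule prod_primes_dvd)
    show "finite S" by (rule finite_subset[of _ "{..2 * n}"]) (auto simp: S_def)
    fix p assume p: "p \<in> S"
    have "fact n * fact n * (2 * n choose n) = fact (2 * n)"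
      using binomial_fact_lemma[of n "2 * n"] by simp
    moreover have "p dvd fact (2 * n)" "\<not> p dvd fact n"
      using p by (auto simp: S_def prime_dvd_fact_iff)
    ultimately show "prime p \<and> p dvd (2 * n choose n)"
      using p by (metis (no_types, lifting) S_def mem_Collect_eq prime_dvd_mult_nat)
  qed
  then have "\<Prod>S \<le> (2 * n choose n)"
    by (rule dvd_imp_le) simp
  also have "\<dots> \<le> 2 ^ (2 * n)" by (rule binomial_le_pow2)
  also have "\<dots> = 4 ^ n" by (simp add: power_mult)
  finally have S: "\<Prod>S \<le> 4 ^ n" .
  have "{p::nat. prime p \<and> p \<le> 2 ^ Suc r} = {p. prime p \<and> p \<le> n} \<union> S"
    by (auto simp: S_def n_def)
  moreover have "\<Prod>({p. prime p \<and> p \<le> n} \<union> S) = \<Prod>{p. prime p \<and> p \<le> n} * \<Prod>S"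
    by (rule prod.union_disjoint)
       (auto simp: S_def intro: finite_subset[of _ "{..n}"] finite_subset[of _ "{..2 * n}"])
  ultimately have "\<Prod>{p::nat. prime p \<and> p \<le> 2 ^ Suc r} \<le> 4 ^ n * 4 ^ n"
    using Suc S by (simp add: n_def mult_le_mono)
  also have "\<dots> = 4 ^ (2 ^ Suc r)"
    by (simp add: n_def power_add[symmetric] mult_2[symmetric])
  finally show ?case .
qed

text \<open>Put \<open>M = 4 ^ s\<close>. Without a prime in the interval, the least common multiple
  of the numbers up to \<open>4 * M\<close> has only prime factors up to \<open>M\<close>, so it is
  at most \<open>4 ^ M\<close> times a comparatively small factor. The binomial bound forces it to
  be at least half of \<open>4 ^ (2 * M)\<close>.\<close>

lemma ex_prime_between_powers:
  assumes "4 \<le> s"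
  shows "\<exists>p::nat. prime p \<and> 4 ^ s < p \<and> p \<le> 4 ^ Suc s"
proof (rule ccontr)
  assume none: "\<not> ?thesis"
  define M where "M = (4::nat) ^ s"
  define N where "N = 4 * M"
  define D where "D = Lcm {1..N}"
  have M0: "0 < M" by (simp add: M_def)
  then have N1: "1 \<le> N" by (simp add: N_def)
  have D0: "0 < D" by (simp add: D_def Lcm_0_iff Nat.gr0_conv_Suc[symmetric] zero_less_iff_neq_zero)
  have two: "(2::nat) ^ (2 * s) = M" by (simp add: M_def power_mult)
  define P where "P = prime_factors D"
  have finP: "finite P" by (simp add: P_def)
  have P: "prime p" "p \<le> M" if "p \<in> P" for p
  proof -
    show p: "prime p" using that by (auto simp: P_def)
    have "p ^ 1 dvd D" using that by (auto simp: P_def)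
    then have "p \<le> 4 ^ Suc s"
      using prime_power_dvd_Lcm_le[OF p N1, of 1] by (simp add: D_def N_def M_def)
    then show "p \<le> M" using none p by (auto simp: M_def not_less)
  qed
  \<comment> \<open>\<open>c\<close> is the square root of \<open>N\<close>: primes above
    \<open>c\<close> divide \<open>D\<close> only once, and the at most \<open>c\<close> smaller
    primes contribute at most \<open>N\<close> each.\<close>
  define c where "c = (2::nat) ^ Suc s"
  have cN: "c * c = N"
    by (simp add: c_def N_def two[symmetric] mult_2[of s] power_add)
  have pw: "p ^ multiplicity p D \<le> N" if "p \<in> P" for p
    using prime_power_dvd_Lcm_le[OF P(1)[OF that] N1] multiplicity_dvd[of p D] by (simp add: D_def)
  have pw': "p ^ multiplicity p D \<le> p" if "p \<in> P" "c < p" for p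
  proof -
    have "multiplicity p D < 2"
    proof (rule ccontr)
      assume "\<not> ?thesis"
      then have "p ^ 2 \<le> p ^ multiplicity p D"
        using that by (intro power_increasing) auto
      then have "p * p \<le> N" using pw[OF that(1)] by (simp add: power2_eq_square)
      moreover have "c * c < p * p" using that(2) by (intro mult_strict_mono) auto
      ultimately show False using cN by simp
    qed
    then have "p ^ multiplicity p D \<le> p ^ 1"
      using that by (intro power_increasing) auto
    then show ?thesis by simp
  qed
  have "D = (\<Prod>p\<in>P. p ^ multiplicity p D)"
    unfolding P_def using D0 by (rule prime_factorization_nat)
  also have "P = {p \<in> P. p \<le> c} \<union> {p \<in> P. c < p}" by auto
  also have "(\<Prod>p\<in>\<dots>. p ^ multiplicity p D) =
      (\<Prod>p\<in>{p \<in> P. p \<le> c}. p ^ multiplicity p D) * (\<Prod>p\<in>{p \<in> P. c < p}. p ^ multiplicity p D)"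
    using finP by (intro prod.union_disjoint) auto
  also have "\<dots> \<le> (\<Prod>p\<in>{p \<in> P. p \<le> c}. N) * (\<Prod>p\<in>{p \<in> P. c < p}. p)"
    using pw pw' by (intro mult_le_mono prod_mono) auto
  also have "(\<Prod>p\<in>{p \<in> P. p \<le> c}. N) \<le> N ^ c"
  proof -
    have "{p \<in> P. p \<le> c} \<subseteq> {1..c}" using P(1) prime_ge_1_nat by auto
    then have "card {p \<in> P. p \<le> c} \<le> c" using card_mono[of "{1..c}"] by fastforce
    then show ?thesis using N1 by (simp add: power_increasing)
  qed
  also have "(\<Prod>p\<in>{p \<in> P. c < p}. p) \<le> \<Prod>{p. prime p \<and> p \<le> 2 ^ (2 * s)}"
  proof (rule dvd_imp_le, rule prod_dvd_prod_subset)
    show fin: "finite {p. prime p \<and> p \<le> (2::nat) ^ (2 * s)}"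
      by (rule finite_subset[of _ "{..2 ^ (2 * s)}"]) auto
    show "{p \<in> P. c < p} \<subseteq> {p. prime p \<and> p \<le> 2 ^ (2 * s)}"
      unfolding two using P by auto
    show "0 < \<Prod>{p. prime p \<and> p \<le> (2::nat) ^ (2 * s)}"
      by (rule prod_pos) (auto dest: prime_gt_0_nat)
  qed
  also have "\<dots> \<le> 4 ^ M"
    using primorial_le[of "2 * s"] by (simp add: two)
  finally have upper: "D \<le> N ^ c * 4 ^ M" by simp
  have "(2 * M) * (2 * (2 * M) choose (2 * M)) dvd D"
    unfolding D_def N_def using mult_binomial_dvd_Lcm[of "2 * M" "4 * M"] M0 by simp
  then have "(2 * M) * (2 * (2 * M) choose (2 * M)) \<le> D"
    using D0 by (rule dvd_imp_le)
  moreover have "4 ^ (2 * M) \<le> 2 * ((2 * M) * (2 * (2 * M) choose (2 * M)))"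
  proof -
    have "4 ^ (2 * M) \<le> 2 * real (2 * M) * real (2 * (2 * M) choose (2 * M))"
      using central_binomial_lower_bound[of "2 * M"] M0 by (simp add: field_simps)
    then have "real (4 ^ (2 * M)) \<le> real (2 * ((2 * M) * (2 * (2 * M) choose (2 * M))))"
      by simp
    then show ?thesis by (simp only: of_nat_le_iff)
  qed
  ultimately have "4 ^ (2 * M) \<le> 2 * (N ^ c * 4 ^ M)"
    using upper by linarith
  also have "N ^ c = 4 ^ (Suc s * c)"
    by (simp only: N_def M_def power_Suc[symmetric] power_mult)
  also have "4 ^ (2 * M) = (4::nat) ^ M * 4 ^ M"
    by (simp add: mult_2 power_add)
  finally have "4 ^ M * 4 ^ M \<le> (2 * 4 ^ (Suc s * c)) * (4::nat) ^ M"
    by (simp add: ac_simps)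
  then have "4 ^ M \<le> 2 * (4::nat) ^ (Suc s * c)"
    by simp
  also have "\<dots> < 4 ^ Suc (Suc s * c)"
    by simp
  finally have "M < Suc (Suc s * c)"
    by (rule power_less_imp_less_exp[rotated]) simp
  then have "2 ^ s * 2 ^ s \<le> 2 * Suc s * (2::nat) ^ s"
    by (simp add: M_def c_def power_mult_distrib[symmetric])
  then have "(2::nat) ^ s \<le> 2 * Suc s"
    by (rule mult_right_le_imp_le) simp
  \<comment> \<open>Equality holds at \<open>s = 3\<close>, so 4 is where the induction can
    start.\<close>
  moreover have "2 * Suc s < (2::nat) ^ s"
    using assms by (induction s rule: dec_induct) auto
  ultimately show False by simp
qed

subsection \<open>Sets with unique sums\<close>

unbundle fps_syntax

text \<open>The reversed polynomial with roots \<open>xs\<close>: up to sign, its coefficients are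
  the elementary symmetric functions. Its constant term 1 suits a logarithmic derivative in power
  series.\<close>

definition root_fps :: "int list \<Rightarrow> int fps" where
  "root_fps xs = (\<Prod>a\<leftarrow>xs. 1 - fps_const a * fps_X)"

lemma root_fps_simps [simp]:
  "root_fps [] = 1" "root_fps (a # xs) = (1 - fps_const a * fps_X) * root_fps xs"
  by (simp_all add: root_fps_def)

text \<open>The series of \<open>a / (1 - a X)\<close> with the denominator cleared.\<close>

lemma geometric_fps:
  fixes a :: "'a::comm_ring_1"
  shows "(1 - fps_const a * fps_X) * Abs_fps (\<lambda>n. a ^ Suc n) = fps_const a"
proof (rule fps_ext)
  fix n
  show "((1 - fps_const a * fps_X) * Abs_fps (\<lambda>n. a ^ Suc n)) $ n = fps_const a $ n"
    by (cases n) (simp_all add: algebra_simps)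
qed

text \<open>The logarithmic derivative: each factor contributes \<open>- a / (1 - a X)\<close>, and
  these series add up to the negated power sums.\<close>

lemma deriv_root_fps:
  "fps_deriv (root_fps xs) = - root_fps xs * Abs_fps (\<lambda>n. \<Sum>a\<leftarrow>xs. a ^ Suc n)"
proof (induction xs)
  case Nil
  then show ?case by (simp add: fps_eq_iff)
next
  case (Cons a xs)
  define S where "S = Abs_fps (\<lambda>n. \<Sum>a\<leftarrow>xs. a ^ Suc n)"
  have split: "Abs_fps (\<lambda>n. \<Sum>a\<leftarrow>a # xs. a ^ Suc n) = Abs_fps (\<lambda>n. a ^ Suc n) + S"
    by (simp add: fps_eq_iff S_def)
  have "fps_deriv (root_fps (a # xs)) = - fps_const a * root_fps xs - (1 - fps_const a * fps_X) * root_fps xs * S"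
    using Cons.IH by (simp add: S_def algebra_simps del: fps_const_neg)
  also have "\<dots> = - ((1 - fps_const a * fps_X) * Abs_fps (\<lambda>n. a ^ Suc n)) * root_fps xs -
      (1 - fps_const a * fps_X) * root_fps xs * S"
    unfolding geometric_fps ..
  also have "\<dots> = - root_fps (a # xs) * (Abs_fps (\<lambda>n. a ^ Suc n) + S)"
    by (simp add: algebra_simps)
  finally show ?case unfolding split .
qed

lemma newton_identity:
  "int (Suc n) * root_fps xs $ Suc n = - (\<Sum>i\<le>n. root_fps xs $ i * (\<Sum>a\<leftarrow>xs. a ^ Suc (n - i)))"
proof -
  have "fps_deriv (root_fps xs) $ n = (- root_fps xs * Abs_fps (\<lambda>n. \<Sum>a\<leftarrow>xs. a ^ Suc n)) $ n"
    by (simp only: deriv_root_fps)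
  then show ?thesis
    by (simp add: fps_mult_nth sum_negf atLeast0AtMost)
qed

lemma root_fps_nth_0 [simp]: "root_fps xs $ 0 = 1"
  by (induction xs) auto

text \<open>Newton's identity determines \<open>n\<close> times coefficient \<open>n\<close> from
  earlier coefficients and power sums. For positive \<open>n \<le> k < p\<close> the factor
  \<open>n\<close> is invertible modulo \<open>p\<close>.\<close>

lemma root_fps_cong:
  fixes p :: nat
  assumes p: "prime p" "k < p"
    and sums: "\<And>i. 1 \<le> i \<Longrightarrow> i \<le> k \<Longrightarrow> [(\<Sum>a\<leftarrow>xs. a ^ i) = (\<Sum>a\<leftarrow>ys. a ^ i)] (mod int p)"
    and "n \<le> k"
  shows "[root_fps xs $ n = root_fps ys $ n] (mod int p)"
  using \<open>n \<le> k\<close>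
proof (induction n rule: less_induct)
  case (less n)
  show ?case
  proof (cases n)
    case 0
    then show ?thesis by simp
  next
    case (Suc m)
    have "[int (Suc m) * root_fps xs $ Suc m = int (Suc m) * root_fps ys $ Suc m] (mod int p)"
      unfolding newton_identity using less Suc
      by (intro cong_minus_minus_iff[THEN iffD2] cong_sum cong_mult sums) auto
    moreover have "coprime (int (Suc m)) (int p)"
    proof -
      have "\<not> p dvd Suc m" using less.prems Suc p(2) by (auto dest: dvd_imp_le)
      then show ?thesis
        using p(1) by (metis coprime_commute coprime_int_iff prime_imp_coprime)
    qed
    ultimately show ?thesis
      using Suc by (simp only: cong_mult_lcancel)
  qed
qed

text \<open>The reversed polynomials of \<open>xs\<close> and \<open>ys\<close> agree modulo
  \<open>p\<close>. The one for \<open>xs\<close> vanishes at the inverse \<open>t\<close> of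
  \<open>x\<close>, hence so does the other, and primality yields a factor \<open>1 - y * t\<close>
  divisible by \<open>p\<close>. The range turns the congruence of \<open>x\<close> and
  \<open>y\<close> into equality.\<close>

lemma power_sums_cong_imp_subset:
  fixes p :: nat
  assumes p: "prime p" "k < p"
    and sums: "\<And>i. 1 \<le> i \<Longrightarrow> i \<le> k \<Longrightarrow> [(\<Sum>a\<leftarrow>xs. a ^ i) = (\<Sum>a\<leftarrow>ys. a ^ i)] (mod int p)"
    and len: "length xs \<le> k" "length ys \<le> k"
    and range: "set xs \<subseteq> {1..<int p}" "set ys \<subseteq> {1..<int p}"
  shows "set xs \<subseteq> set ys"
proof
  fix x assume x: "x \<in> set xs"
  define P where "P zs = (\<Prod>a\<leftarrow>zs. [:1, - a:])" for zs :: "int list"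
  have fps_P: "fps_of_poly (P zs) = root_fps zs" for zs
  proof (induction zs)
    case (Cons a zs)
    have "P (a # zs) = [:1, - a:] * P zs"
      by (simp add: P_def)
    moreover have "fps_of_poly [:1, - a:] = 1 - fps_const a * fps_X"
      by (simp add: fps_of_poly_pCons flip: fps_const_neg)
    ultimately show ?case
      using Cons.IH by (simp only: fps_of_poly_mult root_fps_simps)
  qed (simp add: P_def)
  have coeff_P: "coeff (P zs) n = root_fps zs $ n" for zs n
    by (simp flip: fps_P)
  have degree_P: "degree (P zs) \<le> length zs" for zs
  proof (induction zs)
    case (Cons a zs)
    then show ?case
      using degree_mult_le[of "[:1, - a:]" "P zs"] degree_pCons_le[of 1 "[:- a:]"] by (simp add: P_def)
  qed (simp add: P_def)
  \<comment> \<open>Summing up to \<open>k\<close> instead of the degree allows a comparison term by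
    term even for lists of different lengths.\<close>
  have poly_P: "poly (P zs) t = (\<Sum>i\<le>k. root_fps zs $ i * t ^ i)" if "length zs \<le> k" for zs t
  proof -
    have "poly (P zs) t = (\<Sum>i\<le>degree (P zs). coeff (P zs) i * t ^ i)"
      by (rule poly_altdef)
    also have "\<dots> = (\<Sum>i\<le>k. coeff (P zs) i * t ^ i)"
      using degree_P[of zs] that by (intro sum.mono_neutral_left) (auto simp: coeff_eq_0)
    finally show ?thesis by (simp add: coeff_P)
  qed
  have eval_P: "poly (P zs) t = (\<Prod>a\<leftarrow>zs. 1 - a * t)" for zs t
    by (induction zs) (simp_all add: P_def algebra_simps)
  have cop: "coprime a (int p)" if "a \<in> {1..<int p}" for a
  proof -
    have "\<not> int p dvd a" using that by (auto dest: zdvd_imp_le)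
    then show ?thesis
      using p(1) by (metis coprime_commute prime_imp_coprime prime_int_nat_transfer of_nat_0_le_iff nat_int)
  qed
  obtain t where t: "[x * t = 1] (mod int p)"
    using cong_solve_coprime_int[OF cop] x range by blast
  have "[poly (P ys) t = poly (P xs) t] (mod int p)"
    unfolding poly_P[OF len(1)] poly_P[OF len(2)]
    by (intro cong_sum cong_mult cong_refl cong_sym[OF root_fps_cong[OF p sums]]) auto
  moreover have "[poly (P xs) t = 0] (mod int p)"
  proof -
    have "1 - x * t dvd poly (P xs) t"
      unfolding eval_P using x by (intro prod_list_dvd) auto
    moreover have "int p dvd 1 - x * t"
      using t by (metis cong_iff_dvd_diff cong_sym)
    ultimately show ?thesis by (auto simp: cong_0_iff intro: dvd_trans)
  qed
  ultimately have "int p dvd (\<Prod>a\<leftarrow>ys. 1 - a * t)"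
    unfolding eval_P by (metis cong_0_iff cong_trans)
  moreover have "prime (int p)" using p(1) by simp
  ultimately have "\<exists>y\<in>set ys. int p dvd 1 - y * t"
    by (induction ys) (auto simp: prime_dvd_mult_iff)
  then obtain y where y: "y \<in> set ys" "int p dvd 1 - y * t" ..
  then have "[y * t = x * t] (mod int p)"
    using t by (metis cong_iff_dvd_diff cong_sym cong_trans)
  moreover have "coprime t (int p)"
    using t by (metis coprime_mult_left_iff cong_imp_coprime cong_sym coprime_1_left)
  ultimately have "[y = x] (mod int p)"
    by (simp add: cong_mult_rcancel)
  moreover have "x \<in> {1..<int p}" "y \<in> {1..<int p}"
    using x y(1) range by blast+
  ultimately have "y = x"
    using cong_less_imp_eq_int[of y "int p" x] by simp
  then show "x \<in> set ys" using y by simp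
qed

section \<open>Digit expansions and the moment curve\<close>

lemma digits_unique:
  fixes B :: nat
  assumes "(\<Sum>i<k. f i * B ^ i) = (\<Sum>i<k. g i * B ^ i)"
    and "\<And>i. i < k \<Longrightarrow> f i < B" "\<And>i. i < k \<Longrightarrow> g i < B" and "i < k"
  shows "f i = g i"
  using assms
proof (induction k arbitrary: f g i)
  case (Suc k)
  have split: "(\<Sum>i<Suc k. h i * B ^ i) = h 0 + B * (\<Sum>i<k. h (Suc i) * B ^ i)" for h :: "nat \<Rightarrow> nat"
    by (subst sum.lessThan_Suc_shift) (simp add: sum_distrib_left ac_simps)
  have eq: "f 0 + B * (\<Sum>i<k. f (Suc i) * B ^ i) = g 0 + B * (\<Sum>i<k. g (Suc i) * B ^ i)"
    using Suc.prems(1) by (simp only: split)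
  have B: "f 0 < B" "g 0 < B" using Suc.prems by auto
  have "f 0 = g 0"
    using arg_cong[OF eq, of "\<lambda>x. x mod B"] B by simp
  with eq B have "(\<Sum>i<k. f (Suc i) * B ^ i) = (\<Sum>i<k. g (Suc i) * B ^ i)" by simp
  then have "f (Suc i) = g (Suc i)" if "i < k" for i
    using Suc.IH[of "\<lambda>i. f (Suc i)" "\<lambda>i. g (Suc i)" i] Suc.prems that by auto
  then show ?case
    using \<open>f 0 = g 0\<close> Suc.prems(4) by (cases i) auto
qed simp

lemma digits_less:
  fixes B :: nat
  assumes "\<And>i. i < k \<Longrightarrow> f i < B"
  shows "(\<Sum>i<k. f i * B ^ i) < B ^ k"
  using assms
proof (induction k)
  case (Suc k)
  have "(\<Sum>i<Suc k. f i * B ^ i) < B ^ k + f k * B ^ k"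
    using Suc by simp
  also have "\<dots> = Suc (f k) * B ^ k" by simp
  also have "\<dots> \<le> B * B ^ k"
    using Suc.prems[of k] by (intro mult_le_mono1) simp
  finally show ?case by simp
qed simp

text \<open>The moment curve in \<open>(\<int>/p)\<^sup>k\<close>, written in base \<open>k * p\<close> so that sums of
  at most \<open>k\<close> codes have no carries.\<close>

definition moment_code :: "nat \<Rightarrow> nat \<Rightarrow> nat \<Rightarrow> nat" where
  "moment_code k p a = (\<Sum>i<k. (a ^ Suc i mod p) * (k * p) ^ i)"

text \<open>A B_k set, phrased by supports of the sums. Cancelling common entries would recover
  equality of multisets, but containment of supports is the form in which the cycle argument uses
  it.\<close>

definition sidon_set :: "nat \<Rightarrow> nat set \<Rightarrow> bool" where
  "sidon_set k D \<longleftrightarrow>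
     (\<forall>xs ys. length xs = length ys \<and> length xs \<le> k \<and> set xs \<subseteq> D \<and> set ys \<subseteq> D \<and>
        sum_list xs = sum_list ys \<longrightarrow> set xs \<subseteq> set ys)"

lemma moment_code_less:
  assumes "0 < k" "0 < p"
  shows "moment_code k p a < (k * p) ^ k"
  unfolding moment_code_def
proof (rule digits_less)
  fix i
  have "a ^ Suc i mod p < p" using assms by simp
  also have "p \<le> k * p" using assms by simp
  finally show "a ^ Suc i mod p < k * p" .
qed

text \<open>Digit sums of at most \<open>k\<close> codes stay below the base \<open>k * p\<close>,
  so equal totals have equal digit sums. Modulo \<open>p\<close> these are the power sums of the
  parameters.\<close>

lemma moment_code_subset:
  assumes p: "prime p" "k < p"
    and len: "length xs = length ys" "length xs \<le> k"
    and range: "set xs \<subseteq> {1..<p}" "set ys \<subseteq> {1..<p}"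
    and eq: "(\<Sum>a\<leftarrow>xs. moment_code k p a) = (\<Sum>a\<leftarrow>ys. moment_code k p a)"
  shows "set xs \<subseteq> set ys"
proof (cases "xs = []")
  case False
  then have ys: "ys \<noteq> []" using len by auto
  have p0: "0 < p" using p(2) by simp
  have digits: "(\<Sum>a\<leftarrow>zs. moment_code k p a) = (\<Sum>i<k. (\<Sum>a\<leftarrow>zs. a ^ Suc i mod p) * (k * p) ^ i)" for zs
    by (induction zs) (simp_all add: moment_code_def sum.distrib algebra_simps)
  have small: "(\<Sum>a\<leftarrow>zs. a ^ Suc i mod p) < k * p" if "length zs \<le> k" "zs \<noteq> []" for zs i
  proof -
    have "(\<Sum>a\<leftarrow>zs. a ^ Suc i mod p) < length zs * p" if "zs \<noteq> []" for zs :: "nat list"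
      using that
    proof (induction zs rule: list_nonempty_induct)
      case (single x)
      then show ?case using p0 by simp
    next
      case (cons x xs)
      then show ?case using p0 by (simp add: add_strict_mono del: power_Suc)
    qed
    also have "length zs * p \<le> k * p" using that by simp
    finally show ?thesis using that by simp
  qed
  have "[(\<Sum>a\<leftarrow>map int xs. a ^ i) = (\<Sum>a\<leftarrow>map int ys. a ^ i)] (mod int p)" if i: "1 \<le> i" "i \<le> k" for i
  proof -
    obtain j where j: "i = Suc j" "j < k" using i by (cases i) auto
    have "(\<Sum>a\<leftarrow>xs. a ^ Suc j mod p) = (\<Sum>a\<leftarrow>ys. a ^ Suc j mod p)"
      by (rule digits_unique[where k = k and B = "k * p" and i = j
            and f = "\<lambda>i. \<Sum>a\<leftarrow>xs. a ^ Suc i mod p" and g = "\<lambda>i. \<Sum>a\<leftarrow>ys. a ^ Suc i mod p"])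
         (use eq small len False ys j in \<open>auto simp: digits simp del: power_Suc\<close>)
    moreover have "(\<Sum>a\<leftarrow>zs. a ^ i) mod p = (\<Sum>a\<leftarrow>zs. a ^ i mod p) mod p" for zs
      by (induction zs) (simp_all, metis mod_add_eq mod_mod_trivial)
    ultimately have "[(\<Sum>a\<leftarrow>xs. a ^ i) = (\<Sum>a\<leftarrow>ys. a ^ i)] (mod p)"
      by (simp only: cong_def j)
    moreover have "int (\<Sum>a\<leftarrow>zs. a ^ i) = (\<Sum>a\<leftarrow>map int zs. a ^ i)" for zs
      by (induction zs) auto
    ultimately show ?thesis by (metis cong_int_iff)
  qed
  then have "set (map int xs) \<subseteq> set (map int ys)"
    by (rule power_sums_cong_imp_subset[OF p]) (use len range in auto)
  then show ?thesis by auto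
qed simp

lemma sidon_moment_code:
  assumes "prime p" "k < p"
  shows "sidon_set k (moment_code k p ` {1..<p})"
  unfolding sidon_set_def
proof (intro allI impI, elim conjE)
  fix xs ys
  assume len: "length xs = length ys" "length xs \<le> k" and eq: "sum_list xs = sum_list ys"
    and sub: "set xs \<subseteq> moment_code k p ` {1..<p}" "set ys \<subseteq> moment_code k p ` {1..<p}"
  have "\<exists>zs'. zs = map (moment_code k p) zs' \<and> set zs' \<subseteq> {1..<p}"
    if "set zs \<subseteq> moment_code k p ` {1..<p}" for zs
    using that
  proof (induction zs)
    case (Cons z zs)
    then obtain zs' a where "zs = map (moment_code k p) zs'" "set zs' \<subseteq> {1..<p}"
      "z = moment_code k p a" "a \<in> {1..<p}" by auto
    then show ?case by (intro exI[of _ "a # zs'"]) auto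
  qed simp
  then obtain xs' ys' where "xs = map (moment_code k p) xs'" "set xs' \<subseteq> {1..<p}"
    "ys = map (moment_code k p) ys'" "set ys' \<subseteq> {1..<p}"
    using sub by metis
  then show "set xs \<subseteq> set ys"
    using moment_code_subset[OF assms, of xs' ys'] len eq by auto
qed

lemma inj_on_moment_code:
  assumes "prime p" "k < p" "0 < k"
  shows "inj_on (moment_code k p) {1..<p}"
proof (rule inj_onI)
  fix a b assume "a \<in> {1..<p}" "b \<in> {1..<p}" "moment_code k p a = moment_code k p b"
  then show "a = b" using moment_code_subset[OF assms(1,2), of "[a]" "[b]"] assms(3) by auto
qed

text \<open>Digit 0 is \<open>a\<close> itself. Positivity keeps 0 out of the difference set, so
  every difference gives a genuine edge.\<close>

lemma moment_code_pos:
  assumes "0 < k" "a \<in> {1..<p}"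
  shows "0 < moment_code k p a"
proof -
  have "0 < (a ^ Suc 0 mod p) * (k * p) ^ 0" using assms by simp
  also have "\<dots> \<le> moment_code k p a"
    unfolding moment_code_def using assms by (intro member_le_sum) auto
  finally show ?thesis .
qed

subsection \<open>Difference graphs\<close>

definition diff_graph :: "nat \<Rightarrow> nat set \<Rightarrow> nat ograph" where
  "diff_graph n D = \<lparr>verts = {..<n}, edges = {{u, u + d} | u d. d \<in> D \<and> u + d < n}\<rparr>"

lemma verts_diff_graph [simp]: "verts (diff_graph n D) = {..<n}"
  by (simp add: diff_graph_def)

lemma ordered_graph_diff_graph:
  assumes "0 \<notin> D"
  shows "ordered_graph (diff_graph n D)"
  using assms by (auto simp: ordered_graph_def diff_graph_def card_2_iff) (metis add_cancel_left_right)

lemma card_edges_diff_graph: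
  assumes "finite D" "0 \<notin> D" "\<And>d. d \<in> D \<Longrightarrow> d \<le> m"
  shows "card D * (n - m) \<le> card (edges (diff_graph n D))"
proof -
  have "inj_on (\<lambda>(d, u). {u, u + d}) (D \<times> {..<n - m})"
    using assms(2) by (auto simp: inj_on_def doubleton_eq_iff)
  moreover have "(\<lambda>(d, u). {u, u + d}) ` (D \<times> {..<n - m}) \<subseteq> edges (diff_graph n D)"
  proof safe
    fix d u assume d: "d \<in> D" and u: "u < n - m"
    then have "u + d < n" using assms(3)[OF d] by linarith
    then show "{u, u + d} \<in> edges (diff_graph n D)"
      using d by (auto simp: diff_graph_def)
  qed
  moreover have "finite (edges (diff_graph n D))"
    by (rule finite_subset[of _ "Pow {..<n}"]) (auto simp: diff_graph_def)
  ultimately have "card (D \<times> {..<n - m}) \<le> card (edges (diff_graph n D))"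
    by (rule card_inj_on_le)
  then show ?thesis by (simp add: card_cartesian_product)
qed

text \<open>Two positions could carry the same edge only on a cycle of length 2.\<close>

lemma cycle_edge_eq:
  assumes "distinct vs" "3 \<le> length vs" "i < length vs" "j < length vs"
    and eq: "{vs ! i, vs ! (Suc i mod length vs)} = {vs ! j, vs ! (Suc j mod length vs)}"
  shows "i = j"
proof (rule ccontr)
  assume "i \<noteq> j"
  have "0 < length vs" using assms(2) by linarith
  then have lt: "Suc i mod length vs < length vs" "Suc j mod length vs < length vs"
    by (rule mod_less_divisor)+
  have "i = Suc j mod length vs" "Suc i mod length vs = j"
    using eq \<open>i \<noteq> j\<close> assms lt by (auto simp: doubleton_eq_iff nth_eq_iff_index_eq)
  then show False
    using assms(2-4) by (auto simp: mod_Suc split: if_splits)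
qed

text \<open>Under a monotone injection the outer border spans the largest difference and is the only
  edge to do so, while unique sums make every difference recur at a position of the other
  parity.\<close>

lemma diff_graph_no_bordered_cycle:
  fixes H :: "'a::linorder ograph"
  assumes sidon: "sidon_set k D" and "0 \<notin> D"
    and H: "bordered_cycle H" "card (verts H) = 2 * j" "j \<le> k"
  shows "\<not> contains_ograph (diff_graph n D) H"
proof
  assume "contains_ograph (diff_graph n D) H"
  then obtain f where f: "inj_on f (verts H)" "mono_on (verts H) f"
    and fE: "\<And>e. e \<in> edges H \<Longrightarrow> f ` e \<in> edges (diff_graph n D)"
    unfolding contains_ograph_def by blast
  obtain vs where vs: "distinct vs" "3 \<le> length vs" "verts H = set vs"
    and EH: "edges H = {{vs ! i, vs ! (Suc i mod length vs)} | i. i < length vs}"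
    using H(1) by (auto simp: bordered_cycle_def is_cycle_def)
  obtain U V where col: "interval_coloring H {U, V}" and UV: "\<And>u v. u \<in> U \<Longrightarrow> v \<in> V \<Longrightarrow> u < v"
    and outer: "{Min U, Max V} \<in> edges H"
    using H(1) by (auto simp: bordered_cycle_def)
  have len: "length vs = 2 * j" using H(2) vs distinct_card by fastforce
  then have "0 < j" using vs(2) by auto
  have union: "U \<union> V = set vs"
    using col vs(3) by (auto simp: interval_coloring_def partition_on_def)
  then have fin: "finite U" "finite V"
    by (metis List.finite_set finite_Un)+
  have cross: "x \<in> U \<and> y \<in> V \<or> x \<in> V \<and> y \<in> U" if "{x, y} \<in> edges H" "x \<in> set vs" "y \<in> set vs" for x y
  proof -
    have "x \<in> U \<union> V" "y \<in> U \<union> V"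
      using that union by auto
    moreover have "\<forall>a\<in>U. \<forall>b\<in>U. {a, b} \<notin> edges H" "\<forall>a\<in>V. \<forall>b\<in>V. {a, b} \<notin> edges H"
      using col by (auto simp: interval_coloring_def)
    ultimately show ?thesis using that(1) by blast
  qed
  \<comment> \<open>Cyclic indexing gives \<open>w (2 * j) = w 0\<close>, which closes the
    telescoping sum.\<close>
  define w where "w i = vs ! (i mod length vs)" for i
  have len0: "0 < length vs" using vs(2) by linarith
  have w_edge: "{w i, w (Suc i)} \<in> edges H" for i
    unfolding EH w_def using mod_less_divisor[OF len0]
    by (intro CollectI exI[of _ "i mod length vs"]) (simp add: mod_Suc_eq)
  have w_set: "w i \<in> set vs" for i
    unfolding w_def using len0 by (intro nth_mem mod_less_divisor)
  have "\<exists>d\<in>D. \<exists>u\<in>U. \<exists>v\<in>V. {w i, w (Suc i)} = {u, v} \<and> f v = f u + d" for i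
  proof -
    obtain u v where uv: "u \<in> U" "v \<in> V" "{w i, w (Suc i)} = {u, v}"
      using cross[OF w_edge w_set w_set, of i] by (auto simp: insert_commute)
    have "{f u, f v} \<in> edges (diff_graph n D)"
      using fE[OF w_edge[of i]] uv(3) by simp
    then obtain a d where ad: "{f u, f v} = {a, a + d}" "d \<in> D" by (auto simp: diff_graph_def)
    have "f u \<le> f v"
      using UV[OF uv(1,2)] f(2) uv union vs(3) by (auto intro!: mono_onD[OF f(2)])
    then have "f v = f u + d"
      using ad by (auto simp: doubleton_eq_iff)
    then show ?thesis using uv ad by blast
  qed
  then obtain d where d: "\<And>i. d i \<in> D \<and> (\<exists>u\<in>U. \<exists>v\<in>V. {w i, w (Suc i)} = {u, v} \<and> f v = f u + d i)"
    by metis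

  \<comment> \<open>With left vertices counted negatively, the difference along an edge is a sum
    over its two ends, whichever way the cycle traverses it. Odd minus even positions then
    telescopes.\<close>
  define \<sigma> where "\<sigma> z = (if z \<in> V then int (f z) else - int (f z))" for z
  have \<sigma>: "int (d i) = \<sigma> (w i) + \<sigma> (w (Suc i))" for i
  proof -
    obtain u v where uv: "u \<in> U" "v \<in> V" "{w i, w (Suc i)} = {u, v}" "f v = f u + d i"
      using d by blast
    have "u \<notin> V" using UV uv(1) by blast
    then show ?thesis
      using uv by (auto simp: \<sigma>_def doubleton_eq_iff)
  qed
  have "(\<Sum>i<j. int (d (Suc (2 * i)))) - (\<Sum>i<j. int (d (2 * i)))
      = (\<Sum>i<j. \<sigma> (w (2 * Suc i)) - \<sigma> (w (2 * i)))"
    by (simp add: \<sigma> sum_subtractf[symmetric])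
  also have "\<dots> = \<sigma> (w (2 * j)) - \<sigma> (w 0)"
    using sum_lessThan_telescope[of "\<lambda>i. \<sigma> (w (2 * i))" j] by (simp only: mult_0_right)
  also have "\<dots> = 0"
    using len by (simp add: w_def)
  finally have "int (\<Sum>i<j. d (Suc (2 * i))) = int (\<Sum>i<j. d (2 * i))"
    by simp
  then have sums: "(\<Sum>i<j. d (2 * i)) = (\<Sum>i<j. d (Suc (2 * i)))"
    by (simp only: of_nat_eq_iff)
  have sub: "d ` g ` {..<j} \<subseteq> d ` h ` {..<j}"
    if "(\<Sum>i<j. d (g i)) = (\<Sum>i<j. d (h i))" for g h :: "nat \<Rightarrow> nat"
  proof -
    have "set (map (\<lambda>i. d (g i)) [0..<j]) \<subseteq> set (map (\<lambda>i. d (h i)) [0..<j])"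
      using sidon that d H(3) unfolding sidon_set_def
      by (elim allE[of _ "map (\<lambda>i. d (g i)) [0..<j]"] allE[of _ "map (\<lambda>i. d (h i)) [0..<j]"])
         (auto simp: interv_sum_list_conv_sum_set_nat atLeast0LessThan)
    then show ?thesis by (auto simp: image_image atLeast0LessThan)
  qed

  obtain i0 where i0: "i0 < 2 * j" "{w i0, w (Suc i0)} = {Min U, Max V}"
    using outer len by (auto simp: EH w_def)
  \<comment> \<open>The repeated difference is found at the opposite parity, which guarantees a
    different position.\<close>
  have "\<exists>i1<2 * j. i1 \<noteq> i0 \<and> d i1 = d i0"
  proof (cases "even i0")
    case True
    then have "d i0 \<in> d ` (\<lambda>i. 2 * i) ` {..<j}"
      using i0 by (auto elim!: evenE)
    then obtain i where "i < j" "d i0 = d (Suc (2 * i))"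
      using sub[OF sums] by auto
    then show ?thesis using True by (intro exI[of _ "Suc (2 * i)"]) auto
  next
    case False
    then have "d i0 \<in> d ` (\<lambda>i. Suc (2 * i)) ` {..<j}"
      using i0 by (auto elim!: oddE)
    then obtain i where "i < j" "d i0 = d (2 * i)"
      using sub[OF sums[symmetric]] by auto
    then show ?thesis using False by (intro exI[of _ "2 * i"]) auto
  qed
  then obtain i1 where i1: "i1 < 2 * j" "i1 \<noteq> i0" "d i1 = d i0" by blast
  obtain u v where uv: "u \<in> U" "v \<in> V" "{w i1, w (Suc i1)} = {u, v}" "f v = f u + d i1"
    using d by blast
  obtain u0 v0 where uv0: "u0 \<in> U" "v0 \<in> V" "{w i0, w (Suc i0)} = {u0, v0}" "f v0 = f u0 + d i0"
    using d by blast
  have M: "Min U \<in> U" "Max V \<in> V"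
    using Min_in[OF fin(1)] Max_in[OF fin(2)] uv(1,2) by blast+
  then have "u0 = Min U" "v0 = Max V"
    using i0(2) uv0 UV by (auto simp: doubleton_eq_iff)
  \<comment> \<open>The images of \<open>u\<close> and \<open>v\<close> lie between those of the
    outer border, so an equal difference leaves no slack at either end.\<close>
  moreover have "f (Min U) \<le> f u" "f v \<le> f (Max V)"
    using M uv(1,2) fin union vs(3) by (auto intro!: mono_onD[OF f(2)])
  ultimately have "f u = f (Min U)" "f v = f (Max V)"
    using uv(4) uv0(4) i1(3) by auto
  then have "u = Min U" "v = Max V"
    using M uv(1,2) union vs(3) by (auto intro!: inj_onD[OF f(1)])
  then have "{w i1, w (Suc i1)} = {w i0, w (Suc i0)}"
    using uv(3) i0(2) by simp
  then show False
    using cycle_edge_eq[OF vs(1,2), of i1 i0] i0(1) i1(1,2) len by (simp add: w_def)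
qed

section \<open>The extremal function\<close>

text \<open>Edges are subsets of the vertex set, so the crude bound \<open>2 ^ n\<close> gives the
  finiteness that \<open>Max\<close> requires.\<close>

lemma finite_ex_ord_set:
  "finite {card (edges G) | G :: nat ograph.
     ordered_graph G \<and> card (verts G) = n \<and> (\<forall>H \<in> F. \<not> contains_ograph G H)}"
proof (rule finite_subset)
  show "{card (edges G) | G :: nat ograph.
     ordered_graph G \<and> card (verts G) = n \<and> (\<forall>H \<in> F. \<not> contains_ograph G H)} \<subseteq> {..2 ^ n}"
  proof (rule subsetI, elim CollectE exE conjE)
    fix m and G :: "nat ograph"
    assume m: "m = card (edges G)" and G: "ordered_graph G" "card (verts G) = n"
    then have "finite (verts G)" "edges G \<subseteq> Pow (verts G)"
      by (auto simp: ordered_graph_def)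
    then have "card (edges G) \<le> card (Pow (verts G))"
      by (intro card_mono) auto
    then show "m \<in> {..2 ^ n}"
      using \<open>finite (verts G)\<close> m G(2) by (simp add: card_Pow)
  qed
qed simp

lemma ex_ord_ge:
  fixes G :: "nat ograph"
  assumes "ordered_graph G" "card (verts G) = n" "\<And>H. H \<in> F \<Longrightarrow> \<not> contains_ograph G H"
  shows "card (edges G) \<le> ex_ord n F"
  unfolding ex_ord_def using assms by (intro Max_ge finite_ex_ord_set) blast

text \<open>The edgeless graph shows that the maximum is taken over a nonempty set.\<close>

lemma ex_ord_attained:
  assumes "\<And>H. H \<in> F \<Longrightarrow> edges H \<noteq> {}"
  obtains G :: "nat ograph" where "ordered_graph G" "card (verts G) = n"
    "\<forall>H \<in> F. \<not> contains_ograph G H" "ex_ord n F = card (edges G)"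
proof -
  define G0 :: "nat ograph" where "G0 = \<lparr>verts = {..<n}, edges = {}\<rparr>"
  have "ordered_graph G0" "card (verts G0) = n" "\<forall>H \<in> F. \<not> contains_ograph G0 H"
    using assms by (auto simp: G0_def ordered_graph_def contains_ograph_def)
  then have "{card (edges G) | G :: nat ograph. ordered_graph G \<and> card (verts G) = n \<and>
      (\<forall>H \<in> F. \<not> contains_ograph G H)} \<noteq> {}" by blast
  then have "ex_ord n F \<in> {card (edges G) | G :: nat ograph. ordered_graph G \<and> card (verts G) = n \<and>
      (\<forall>H \<in> F. \<not> contains_ograph G H)}"
    unfolding ex_ord_def by (intro Max_in finite_ex_ord_set)
  then show ?thesis using that by auto
qed

subsection \<open>Asymptotics\<close>

lemma ex_ord_bordered_le:
  assumes "0 < k" "0 < n"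
  shows "real (ex_ord n (\<Union>j \<in> {2..k}. bordered_cycles (2 * j)))
           \<le> 8 * real k * real n powr (1 + 1 / real k)"
proof -
  have "edges H \<noteq> {}" if "H \<in> (\<Union>j \<in> {2..k}. bordered_cycles (2 * j))" for H
    using that by (auto simp: bordered_cycles_def bordered_cycle_def)
  then obtain G :: "nat ograph" where "ordered_graph G" "card (verts G) = n"
    "\<forall>H \<in> (\<Union>j \<in> {2..k}. bordered_cycles (2 * j)). \<not> contains_ograph G H"
    "ex_ord n (\<Union>j \<in> {2..k}. bordered_cycles (2 * j)) = card (edges G)"
    by (rule ex_ord_attained)
  then show ?thesis
    using card_edges_free_le[of G n k] assms by simp
qed

text \<open>There are \<open>p - 1\<close> differences, all at most \<open>n / 2\<close>, so each
  yields at least \<open>n / 2\<close> edges; replacing \<open>p - 1\<close> by \<open>p / 2\<close>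
  gives the factor 4.\<close>

lemma ex_ord_bordered_ge_prime:
  assumes "prime p" "k < p" "0 < k" "2 * (k * p) ^ k \<le> n"
  shows "real p * real n / 4 \<le> real (ex_ord n (\<Union>j \<in> {2..k}. bordered_cycles (2 * j)))"
proof -
  define D where "D = moment_code k p ` {1..<p}"
  have D: "finite D" "card D = p - 1"
    using inj_on_moment_code[OF assms(1-3)] by (simp_all add: D_def card_image)
  have D0: "0 \<notin> D"
    unfolding D_def by (metis imageE less_irrefl moment_code_pos[OF assms(3)])
  have Dm: "d \<le> (k * p) ^ k" if "d \<in> D" for d
    using that moment_code_less[of k p] assms(2,3) by (auto simp: D_def intro!: less_imp_le)
  have free: "\<not> contains_ograph (diff_graph n D) H"
    if H: "H \<in> (\<Union>j \<in> {2..k}. bordered_cycles (2 * j))" for H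
  proof -
    obtain j where "bordered_cycle H" "card (verts H) = 2 * j" "j \<le> k"
      using H by (auto simp: bordered_cycles_def)
    then show ?thesis
      using diff_graph_no_bordered_cycle[OF sidon_moment_code[OF assms(1,2), folded D_def] D0] by blast
  qed
  have "(p - 1) * (n - (k * p) ^ k) \<le> card (edges (diff_graph n D))"
    using card_edges_diff_graph[OF D(1) D0 Dm] D(2) by simp
  also have "\<dots> \<le> ex_ord n (\<Union>j \<in> {2..k}. bordered_cycles (2 * j))"
    by (rule ex_ord_ge[OF ordered_graph_diff_graph[OF D0] _ free]) auto
  finally have ge: "(p - 1) * (n - (k * p) ^ k) \<le> ex_ord n (\<Union>j \<in> {2..k}. bordered_cycles (2 * j))" .
  have "p \<le> 2 * (p - 1)" "n \<le> 2 * (n - (k * p) ^ k)"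
    using assms(2-4) by auto
  then have "p * n \<le> (2 * (p - 1)) * (2 * (n - (k * p) ^ k))"
    by (rule mult_le_mono)
  also have "\<dots> \<le> 4 * ex_ord n (\<Union>j \<in> {2..k}. bordered_cycles (2 * j))"
    using ge by simp
  finally have "real (p * n) \<le> real (4 * ex_ord n (\<Union>j \<in> {2..k}. bordered_cycles (2 * j)))"
    by (simp only: of_nat_le_iff)
  then show ?thesis by simp
qed

text \<open>The real number \<open>X\<close> is the largest value allowed for \<open>p\<close>, and
  a prime is found between \<open>X / 16\<close> and \<open>X\<close>. The constant is
  \<open>128 = 4 * 16 * 2\<close>: from the bound for a given prime, from the gap between
  \<open>X\<close> and \<open>p\<close>, and from the root of \<open>n / 2\<close>.\<close>

lemma ex_ord_bordered_ge:
  assumes "0 < k" and n: "2 * (1024 * k * k) ^ k \<le> n"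
  shows "real n powr (1 + 1 / real k) / (128 * real k)
           \<le> real (ex_ord n (\<Union>j \<in> {2..k}. bordered_cycles (2 * j)))"
proof -
  have n0: "0 < n"
    by (rule order_less_le_trans[OF _ n]) (use assms(1) in simp)
  define R where "R = (real n / 2) powr (1 / real k)"
  define X where "X = R / real k"
  have R0: "0 < R" using n0 by (simp add: R_def)
  have Rk: "R ^ k = real n / 2"
    using assms(1) n0 by (simp add: R_def powr_realpow[symmetric] powr_powr)
  have root: "real m \<le> R" if "2 * m ^ k \<le> n" for m
  proof -
    have "real (2 * m ^ k) \<le> real n" using that by (simp only: of_nat_le_iff)
    then have "real m ^ k \<le> R ^ k" by (simp add: Rk)
    then show ?thesis
      using R0 assms(1) by (metis less_imp_le power_mono_iff of_nat_0_le_iff)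
  qed
  have X: "1024 * real k \<le> X"
    using root[OF n] assms(1) by (simp add: X_def field_simps)
  \<comment> \<open>With \<open>t = s + 2\<close>, a prime above \<open>4 ^ s\<close> and up to
    \<open>4 ^ (s + 1)\<close> is below \<open>X\<close> by at most a factor 16. The constant
    \<open>1024 = 4 ^ 5\<close> in the threshold for \<open>n\<close> ensures
    \<open>4 \<le> s\<close> and also leaves room for \<open>k < p\<close>.\<close>
  define t where "t = (LEAST t. X < 4 ^ t)"
  obtain t0 where "X < 4 ^ t0" using real_arch_pow[of 4 X] by auto
  then have t: "X < 4 ^ t"
    unfolding t_def by (rule LeastI)
  have "1 \<le> real k" using assms(1) by simp
  with X have "1024 \<le> X" by linarith
  with t have "(4::real) ^ 5 < 4 ^ t" by simp
  then have "5 < t" by (rule power_less_imp_less_exp[rotated]) simp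
  then obtain s where s: "t = Suc (Suc s)" "4 \<le> s"
    by (intro that[of "t - 2"]) auto
  have sX: "4 ^ Suc s \<le> X"
    using not_less_Least[of "Suc s" "\<lambda>t. X < 4 ^ t"] s(1) by (simp add: t_def not_less)
  obtain p :: nat where p: "prime p" "4 ^ s < p" "p \<le> 4 ^ Suc s"
    using ex_prime_between_powers[OF s(2)] by blast
  have "real p \<le> real (4 ^ Suc s)" using p(3) by (simp only: of_nat_le_iff)
  then have pX: "real p \<le> X" using sX by simp
  have "real (4 ^ s) < real p" using p(2) by (simp only: of_nat_less_iff)
  moreover have "X < 16 * real (4 ^ s)" using t s(1) by simp
  ultimately have Xp: "X < 16 * real p" by linarith
  have "real k < real p" using X Xp by simp
  then have "k < p" by simp
  moreover have "2 * (k * p) ^ k \<le> n"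
  proof -
    have "real k * real p \<le> R"
      using pX assms(1) by (simp add: X_def field_simps)
    then have "(real k * real p) ^ k \<le> R ^ k"
      by (intro power_mono) auto
    then have "real (2 * (k * p) ^ k) \<le> real n"
      by (simp add: Rk)
    then show ?thesis by (simp only: of_nat_le_iff)
  qed
  ultimately have lower: "real p * real n / 4 \<le> real (ex_ord n (\<Union>j \<in> {2..k}. bordered_cycles (2 * j)))"
    using ex_ord_bordered_ge_prime[OF p(1) _ assms(1)] by blast
  \<comment> \<open>The \<open>k\<close>-th root of \<open>1 / 2\<close> is at least
    \<open>1 / 2\<close>.\<close>
  have "real n powr (1 / real k) / 2 \<le> R"
  proof -
    have "(1 / 2 :: real) powr 1 \<le> (1 / 2) powr (1 / real k)"
      using assms(1) by (intro powr_mono') auto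
    then have "real n powr (1 / real k) * (1 / 2) \<le> real n powr (1 / real k) * (1 / 2) powr (1 / real k)"
      by (intro mult_left_mono) auto
    also have "\<dots> = (real n * (1 / 2)) powr (1 / real k)"
      by (intro powr_mult[symmetric])
    finally show ?thesis by (simp add: R_def)
  qed
  then have "real n powr (1 / real k) / (2 * real k) \<le> X"
    using assms(1) by (simp add: X_def field_simps)
  then have "real n powr (1 / real k) / (2 * real k) \<le> 16 * real p"
    using Xp by linarith
  then have "real n * (real n powr (1 / real k) / (2 * real k)) \<le> real n * (16 * real p)"
    by (intro mult_left_mono) auto
  moreover have "real n powr (1 + 1 / real k) = real n * real n powr (1 / real k)"
    using n0 by (simp add: powr_add)
  ultimately have "real n powr (1 + 1 / real k) / (128 * real k) \<le> real p * real n / 4"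
    by (simp add: field_simps)
  then show ?thesis using lower by linarith
qed

theorem theorem2:
  fixes k :: nat
  assumes "k > 1"
  shows "(\<lambda>n. real (ex_ord n (\<Union>j \<in> {2..k}. bordered_cycles (2 * j))))
           \<in> \<Theta>(\<lambda>n. real n powr (1 + 1 / real k))"
proof (rule bigthetaI)
  have "0 < k" using assms by simp
  show "(\<lambda>n. real (ex_ord n (\<Union>j \<in> {2..k}. bordered_cycles (2 * j))))
      \<in> O(\<lambda>n. real n powr (1 + 1 / real k))"
  proof (rule bigoI)
    show "\<forall>\<^sub>F n in sequentially. norm (real (ex_ord n (\<Union>j \<in> {2..k}. bordered_cycles (2 * j))))
        \<le> 8 * real k * norm (real n powr (1 + 1 / real k))"
      using eventually_gt_at_top[of 0]
      by eventually_elim (use ex_ord_bordered_le[OF \<open>0 < k\<close>] in simp)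
  qed
  show "(\<lambda>n. real (ex_ord n (\<Union>j \<in> {2..k}. bordered_cycles (2 * j))))
      \<in> \<Omega>(\<lambda>n. real n powr (1 + 1 / real k))"
  proof (rule landau_omega.bigI)
    show "0 < 1 / (128 * real k)" using \<open>0 < k\<close> by simp
    show "\<forall>\<^sub>F n in sequentially. norm (real (ex_ord n (\<Union>j \<in> {2..k}. bordered_cycles (2 * j))))
        \<ge> 1 / (128 * real k) * norm (real n powr (1 + 1 / real k))"
      using eventually_ge_at_top[of "2 * (1024 * k * k) ^ k"]
      by eventually_elim (use ex_ord_bordered_ge[OF \<open>0 < k\<close>] in simp)
  qed
qed

end
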